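(* Let $\mathbb A$ be an abelian category with enough projective objects. Then the 2-category $\mathbb A^{[1]}_c$ is a 2-abelian $\mathsf{Gpd}$-category (in the sense of M. Dupont). Moreover: (a) the category of discrete objects of $\mathbb A^{[1]}_c$ (objects: discrete objects; morphisms: 2-isomorphism classes of morphisms) is equivalent to $\mathbb A$, via $a\mapsto \mathrm{Coker}(a)$; (b) the category of codiscrete objects of $\mathbb A^{[1]}_c$ (objects: codiscrete objects; morphisms: 2-isomorphism classes of morphisms) is equivalent to $\mathbb A$, via $a\mapsto \mathrm{Ker}(a)$.
   Context: Let $\mathbb A$ be an abelian category. The 2-category $\mathbb A^{[1]}$ has as objects the morphisms $a:A_1\to A_0$ of $\mathbb A$. For objects $a:A_1\to A_0$ and $b:B_1\to B_0$, a morphism $a\to b$ is a pair $(f_0,f_1)$ of morphisms $f_i:A_i\to B_i$ of $\mathbb A$ with $b f_1=f_0 a$; composition is componentwise. A 2-arrow $(f_0,f_1)\Rightarrow(g_0,g_1)$ between morphisms $a\to b$ is a morphism $\alpha:A_0\to B_1$ of $\mathbb A$ with $f_1-g_1=\alpha a$ and $f_0-g_0=b\alpha$; vertical composition is addition of such $\alpha$'s, and whiskering is given by $(h_0,h_1)\circ\alpha=h_1\alpha$ and $\alpha\circ(e_0,e_1)=\alpha e_0$. All 2-arrows are invertible, so each $\mathbf{Hom}(a,b)$ is a groupoid; the zero object is $0\to 0$. $\mathbb A^{[1]}_c$ is the full 2-subcategory of $\mathbb A^{[1]}$ on the objects $a:A_1\to A_0$ with $A_0$ projective in $\mathbb A$.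 In a 2-category $\mathcal C$ with invertible 2-arrows (a $\mathsf{Gpd}$-category) and zero object: a morphism $f:a\to b$ is faithful (resp. fully faithful) if for every object $x$ the functor $f\circ-:\mathbf{Hom}(x,a)\to\mathbf{Hom}(x,b)$ is faithful (resp. full and faithful); it is cofaithful (resp. fully cofaithful) if for every $x$ the functor $-\circ f:\mathbf{Hom}(b,x)\to\mathbf{Hom}(a,x)$ is faithful (resp. full and faithful). An object $a$ is discrete if $a\to 0$ is faithful and codiscrete if $0\to a$ is cofaithful. A 2-kernel of $f:a\to b$ is a triple $(k,u:k\to a,\kappa:fu\Rightarrow 0)$ such that for every $x$ the functor $v\mapsto (uv,\kappa v)$ from $\mathbf{Hom}(x,k)$ to the groupoid of pairs $(w\in\mathbf{Hom}(x,a),\ \phi:fw\Rightarrow 0)$ is an equivalence; a 2-cokernel is defined dually. A pip of $f:a\to b$ is a universal pair $(p,\pi)$ with $\pi:0\Rightarrow 0$ a 2-arrow between zero morphisms $p\to a$ and $f\pi=\mathrm{id}$; a root of a 2-arrow $\alpha:0\Rightarrow0$ between morphisms $a\to b$ is a universal morphism $r:R\to a$ with $\alpha r=\mathrm{id}$; copips and coroots are dual. Following Dupont, a $\mathsf{Gpd}$-category is 2-abelian if it is 2-additive (hom-groupoids are symmetric 2-groups, composition is bilinear, finite biproducts exist), it has all 2-kernels, 2-cokernels, pips, copips, roots and coroots, and it is 2-Puppe-exact: every faithful morphism is the 2-kernel of its 2-cokernel, every cofaithful morphism is the 2-cokernel of its 2-kernel, every fully faithful morphism is the root of its copip, and every fully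 cofaithful morphism is the coroot of its pip. *)

theory Defs
  imports Main
begin

text \<open>Cmp A g f is the composite g o f (defined when Cod f = Dom g).
  Add, Neg, Zro give the additive (preadditive) structure on hom-sets.\<close>

record ('o,'m) acat =
  Dom :: "'m \<Rightarrow> 'o"
  Cod :: "'m \<Rightarrow> 'o"
  Cmp :: "'m \<Rightarrow> 'm \<Rightarrow> 'm"
  Idt :: "'o \<Rightarrow> 'm"
  Zro :: "'o \<Rightarrow> 'o \<Rightarrow> 'm"
  Add :: "'m \<Rightarrow> 'm \<Rightarrow> 'm"
  Neg :: "'m \<Rightarrow> 'm"

definition hom :: "('o,'m) acat \<Rightarrow> 'o \<Rightarrow> 'o \<Rightarrow> 'm set" where
  "hom A x y = {f. Dom A f = x \<and> Cod A f = y}"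

definition msub :: "('o,'m) acat \<Rightarrow> 'm \<Rightarrow> 'm \<Rightarrow> 'm" where
  "msub A f g = Add A f (Neg A g)"

definition is_category :: "('o,'m) acat \<Rightarrow> bool" where
  "is_category A \<longleftrightarrow>
     (\<forall>f g. Cod A f = Dom A g \<longrightarrow>
        Dom A (Cmp A g f) = Dom A f \<and> Cod A (Cmp A g f) = Cod A g) \<and>
     (\<forall>x. Idt A x \<in> hom A x x) \<and>
     (\<forall>f. Cmp A f (Idt A (Dom A f)) = f \<and> Cmp A (Idt A (Cod A f)) f = f) \<and>
     (\<forall>f g h. Cod A f = Dom A g \<and> Cod A g = Dom A h \<longrightarrow>
        Cmp A h (Cmp A g f) = Cmp A (Cmp A h g) f)"

definition preadditive :: "('o,'m) acat \<Rightarrow> bool" where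
  "preadditive A \<longleftrightarrow>
     (\<forall>x y. Zro A x y \<in> hom A x y \<and>
        (\<forall>f\<in>hom A x y. \<forall>g\<in>hom A x y. \<forall>h\<in>hom A x y.
           Add A f g \<in> hom A x y \<and> Neg A f \<in> hom A x y \<and>
           Add A (Add A f g) h = Add A f (Add A g h) \<and>
           Add A f g = Add A g f \<and>
           Add A f (Zro A x y) = f \<and>
           Add A f (Neg A f) = Zro A x y)) \<and>
     (\<forall>w x y z f g h k. f \<in> hom A x y \<and> g \<in> hom A x y \<and> h \<in> hom A y z \<and> k \<in> hom A w x \<longrightarrow>
        Cmp A h (Add A f g) = Add A (Cmp A h f) (Cmp A h g) \<and>
        Cmp A (Add A f g) k = Add A (Cmp A f k) (Cmp A g k))"

definition has_zero_object :: "('o,'m) acat \<Rightarrow> bool" where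
  "has_zero_object A \<longleftrightarrow>
     (\<exists>z. \<forall>x. (\<exists>!f. f \<in> hom A z x) \<and> (\<exists>!f. f \<in> hom A x z))"

definition has_biproducts :: "('o,'m) acat \<Rightarrow> bool" where
  "has_biproducts A \<longleftrightarrow>
     (\<forall>x y. \<exists>s i1 i2 p1 p2.
        i1 \<in> hom A x s \<and> i2 \<in> hom A y s \<and> p1 \<in> hom A s x \<and> p2 \<in> hom A s y \<and>
        Cmp A p1 i1 = Idt A x \<and> Cmp A p2 i2 = Idt A y \<and>
        Cmp A p1 i2 = Zro A y x \<and> Cmp A p2 i1 = Zro A x y \<and>
        Add A (Cmp A i1 p1) (Cmp A i2 p2) = Idt A s)"

definition is_kernel :: "('o,'m) acat \<Rightarrow> 'm \<Rightarrow> 'm \<Rightarrow> bool" where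
  "is_kernel A f k \<longleftrightarrow>
     Cod A k = Dom A f \<and> Cmp A f k = Zro A (Dom A k) (Cod A f) \<and>
     (\<forall>g. Cod A g = Dom A f \<and> Cmp A f g = Zro A (Dom A g) (Cod A f) \<longrightarrow>
        (\<exists>!h. h \<in> hom A (Dom A g) (Dom A k) \<and> Cmp A k h = g))"

definition is_cokernel :: "('o,'m) acat \<Rightarrow> 'm \<Rightarrow> 'm \<Rightarrow> bool" where
  "is_cokernel A f c \<longleftrightarrow>
     Dom A c = Cod A f \<and> Cmp A c f = Zro A (Dom A f) (Cod A c) \<and>
     (\<forall>g. Dom A g = Cod A f \<and> Cmp A g f = Zro A (Dom A f) (Cod A g) \<longrightarrow>
        (\<exists>!h. h \<in> hom A (Cod A c) (Cod A g) \<and> Cmp A h c = g))"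

definition mono :: "('o,'m) acat \<Rightarrow> 'm \<Rightarrow> bool" where
  "mono A m \<longleftrightarrow> (\<forall>g h. Cod A g = Dom A m \<and> Cod A h = Dom A m \<and> Dom A g = Dom A h \<and>
                       Cmp A m g = Cmp A m h \<longrightarrow> g = h)"

definition epi :: "('o,'m) acat \<Rightarrow> 'm \<Rightarrow> bool" where
  "epi A e \<longleftrightarrow> (\<forall>g h. Dom A g = Cod A e \<and> Dom A h = Cod A e \<and> Cod A g = Cod A h \<and>
                      Cmp A g e = Cmp A h e \<longrightarrow> g = h)"

definition abelian :: "('o,'m) acat \<Rightarrow> bool" where
  "abelian A \<longleftrightarrow> is_category A \<and> preadditive A \<and> has_zero_object A \<and> has_biproducts A \<and>
     (\<forall>f. \<exists>k. is_kernel A f k) \<and> (\<forall>f. \<exists>c. is_cokernel A f c) \<and>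
     (\<forall>m. mono A m \<longrightarrow> (\<exists>f. is_kernel A f m)) \<and>
     (\<forall>e. epi A e \<longrightarrow> (\<exists>f. is_cokernel A f e))"

definition projective :: "('o,'m) acat \<Rightarrow> 'o \<Rightarrow> bool" where
  "projective A P \<longleftrightarrow>
     (\<forall>e g. epi A e \<and> g \<in> hom A P (Cod A e) \<longrightarrow> (\<exists>h\<in>hom A P (Dom A e). Cmp A e h = g))"

definition enough_projectives :: "('o,'m) acat \<Rightarrow> bool" where
  "enough_projectives A \<longleftrightarrow> (\<forall>X. \<exists>P e. projective A P \<and> epi A e \<and> e \<in> hom A P X)"

definition isomorphic :: "('o,'m) acat \<Rightarrow> 'o \<Rightarrow> 'o \<Rightarrow> bool" where
  "isomorphic A X Y \<longleftrightarrow> (\<exists>h g. h \<in> hom A X Y \<and> g \<in> hom A Y X \<and>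
       Cmp A g h = Idt A X \<and> Cmp A h g = Idt A Y)"

text \<open>Objects: arrows a : Dom a -> Cod a of A with Cod a projective (A_1 = Dom a, A_0 = Cod a).
  1-cells a -> b: pairs (f0, f1) with b f1 = f0 a.  2-cells (f0,f1) => (g0,g1):
  alpha : Cod a -> Dom b with f1 - g1 = alpha a and f0 - g0 = b alpha.
  Vertical composition of 2-cells is Add, identity 2-cells are zero arrows,
  whiskering: h o alpha = h1 alpha, alpha o e = alpha e0.\<close>

definition c_obj :: "('o,'m) acat \<Rightarrow> 'm \<Rightarrow> bool" where
  "c_obj A a \<longleftrightarrow> projective A (Cod A a)"

definition c_mor :: "('o,'m) acat \<Rightarrow> 'm \<Rightarrow> 'm \<Rightarrow> 'm \<times> 'm \<Rightarrow> bool" where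
  "c_mor A a b f \<longleftrightarrow> fst f \<in> hom A (Cod A a) (Cod A b) \<and> snd f \<in> hom A (Dom A a) (Dom A b) \<and>
     Cmp A b (snd f) = Cmp A (fst f) a"

definition c_cell :: "('o,'m) acat \<Rightarrow> 'm \<Rightarrow> 'm \<Rightarrow> 'm \<times> 'm \<Rightarrow> 'm \<times> 'm \<Rightarrow> 'm \<Rightarrow> bool" where
  "c_cell A a b f g \<alpha> \<longleftrightarrow> c_mor A a b f \<and> c_mor A a b g \<and> \<alpha> \<in> hom A (Cod A a) (Dom A b) \<and>
     msub A (snd f) (snd g) = Cmp A \<alpha> a \<and> msub A (fst f) (fst g) = Cmp A b \<alpha>"

definition c_comp :: "('o,'m) acat \<Rightarrow> 'm \<times> 'm \<Rightarrow> 'm \<times> 'm \<Rightarrow> 'm \<times> 'm" where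
  "c_comp A g f = (Cmp A (fst g) (fst f), Cmp A (snd g) (snd f))"

definition c_id :: "('o,'m) acat \<Rightarrow> 'm \<Rightarrow> 'm \<times> 'm" where
  "c_id A a = (Idt A (Cod A a), Idt A (Dom A a))"

definition c_zero :: "('o,'m) acat \<Rightarrow> 'm \<Rightarrow> 'm \<Rightarrow> 'm \<times> 'm" where
  "c_zero A a b = (Zro A (Cod A a) (Cod A b), Zro A (Dom A a) (Dom A b))"

definition c_add :: "('o,'m) acat \<Rightarrow> 'm \<times> 'm \<Rightarrow> 'm \<times> 'm \<Rightarrow> 'm \<times> 'm" where
  "c_add A f g = (Add A (fst f) (fst g), Add A (snd f) (snd g))"

definition c_neg :: "('o,'m) acat \<Rightarrow> 'm \<times> 'm \<Rightarrow> 'm \<times> 'm" where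
  "c_neg A f = (Neg A (fst f), Neg A (snd f))"

definition c_idcell :: "('o,'m) acat \<Rightarrow> 'm \<Rightarrow> 'm \<Rightarrow> 'm" where
  "c_idcell A a b = Zro A (Cod A a) (Dom A b)"

definition wl :: "('o,'m) acat \<Rightarrow> 'm \<times> 'm \<Rightarrow> 'm \<Rightarrow> 'm" where
  "wl A h \<alpha> = Cmp A (snd h) \<alpha>"

definition wr :: "('o,'m) acat \<Rightarrow> 'm \<Rightarrow> 'm \<times> 'm \<Rightarrow> 'm" where
  "wr A \<alpha> e = Cmp A \<alpha> (fst e)"

definition c_zero_obj :: "('o,'m) acat \<Rightarrow> 'm \<Rightarrow> bool" where
  "c_zero_obj A z \<longleftrightarrow> c_obj A z \<and>
     (\<forall>x. c_obj A x \<longrightarrow>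
        (\<exists>f. c_mor A x z f) \<and> (\<forall>f g. c_mor A x z f \<and> c_mor A x z g \<longrightarrow> (\<exists>!\<alpha>. c_cell A x z f g \<alpha>)) \<and>
        (\<exists>f. c_mor A z x f) \<and> (\<forall>f g. c_mor A z x f \<and> c_mor A z x g \<longrightarrow> (\<exists>!\<alpha>. c_cell A z x f g \<alpha>)))"

definition c_faithful :: "('o,'m) acat \<Rightarrow> 'm \<Rightarrow> 'm \<Rightarrow> 'm \<times> 'm \<Rightarrow> bool" where
  "c_faithful A a b f \<longleftrightarrow> c_obj A a \<and> c_obj A b \<and> c_mor A a b f \<and>
     (\<forall>x g h \<alpha> \<beta>. c_obj A x \<and> c_cell A x a g h \<alpha> \<and> c_cell A x a g h \<beta> \<and> wl A f \<alpha> = wl A f \<beta>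
        \<longrightarrow> \<alpha> = \<beta>)"

definition c_fully_faithful :: "('o,'m) acat \<Rightarrow> 'm \<Rightarrow> 'm \<Rightarrow> 'm \<times> 'm \<Rightarrow> bool" where
  "c_fully_faithful A a b f \<longleftrightarrow> c_faithful A a b f \<and>
     (\<forall>x g h \<gamma>. c_obj A x \<and> c_mor A x a g \<and> c_mor A x a h \<and>
        c_cell A x b (c_comp A f g) (c_comp A f h) \<gamma> \<longrightarrow> (\<exists>\<alpha>. c_cell A x a g h \<alpha> \<and> wl A f \<alpha> = \<gamma>))"

definition c_cofaithful :: "('o,'m) acat \<Rightarrow> 'm \<Rightarrow> 'm \<Rightarrow> 'm \<times> 'm \<Rightarrow> bool" where
  "c_cofaithful A a b f \<longleftrightarrow> c_obj A a \<and> c_obj A b \<and> c_mor A a b f \<and>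
     (\<forall>x g h \<alpha> \<beta>. c_obj A x \<and> c_cell A b x g h \<alpha> \<and> c_cell A b x g h \<beta> \<and> wr A \<alpha> f = wr A \<beta> f
        \<longrightarrow> \<alpha> = \<beta>)"

definition c_fully_cofaithful :: "('o,'m) acat \<Rightarrow> 'm \<Rightarrow> 'm \<Rightarrow> 'm \<times> 'm \<Rightarrow> bool" where
  "c_fully_cofaithful A a b f \<longleftrightarrow> c_cofaithful A a b f \<and>
     (\<forall>x g h \<gamma>. c_obj A x \<and> c_mor A b x g \<and> c_mor A b x h \<and>
        c_cell A a x (c_comp A g f) (c_comp A h f) \<gamma> \<longrightarrow> (\<exists>\<alpha>. c_cell A b x g h \<alpha> \<and> wr A \<alpha> f = \<gamma>))"

definition c_discrete :: "('o,'m) acat \<Rightarrow> 'm \<Rightarrow> bool" where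
  "c_discrete A a \<longleftrightarrow> c_obj A a \<and> (\<forall>z t. c_zero_obj A z \<and> c_mor A a z t \<longrightarrow> c_faithful A a z t)"

definition c_codiscrete :: "('o,'m) acat \<Rightarrow> 'm \<Rightarrow> bool" where
  "c_codiscrete A a \<longleftrightarrow> c_obj A a \<and> (\<forall>z t. c_zero_obj A z \<and> c_mor A z a t \<longrightarrow> c_cofaithful A z a t)"

text \<open>2-kernel (k, u, kappa) of f : a -> b.  The functor v |-> (u v, kappa v) into the groupoid of
  pairs (w, phi : f w => 0) is required to be an equivalence (essentially surjective, full, faithful).
  A morphism of pairs (w,phi) -> (w',phi') is beta : w => w' with phi = (f beta) followed by phi'.\<close>
definition c_is_2kernel ::
  "('o,'m) acat \<Rightarrow> 'm \<Rightarrow> 'm \<Rightarrow> 'm \<times> 'm \<Rightarrow> 'm \<Rightarrow> 'm \<times> 'm \<Rightarrow> 'm \<Rightarrow> bool" where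
  "c_is_2kernel A a b f k u \<kappa> \<longleftrightarrow>
     c_obj A k \<and> c_mor A k a u \<and> c_cell A k b (c_comp A f u) (c_zero A k b) \<kappa> \<and>
     (\<forall>x. c_obj A x \<longrightarrow>
        (\<forall>w \<phi>. c_mor A x a w \<and> c_cell A x b (c_comp A f w) (c_zero A x b) \<phi> \<longrightarrow>
           (\<exists>v \<beta>. c_mor A x k v \<and> c_cell A x a (c_comp A u v) w \<beta> \<and>
                  wr A \<kappa> v = Add A (wl A f \<beta>) \<phi>)) \<and>
        (\<forall>v v' \<beta>. c_mor A x k v \<and> c_mor A x k v' \<and> c_cell A x a (c_comp A u v) (c_comp A u v') \<beta> \<and>
                  wr A \<kappa> v = Add A (wl A f \<beta>) (wr A \<kappa> v') \<longrightarrow>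
           (\<exists>\<gamma>. c_cell A x k v v' \<gamma> \<and> wl A u \<gamma> = \<beta>)) \<and>
        (\<forall>v v' \<gamma> \<gamma>'. c_cell A x k v v' \<gamma> \<and> c_cell A x k v v' \<gamma>' \<and> wl A u \<gamma> = wl A u \<gamma>' \<longrightarrow> \<gamma> = \<gamma>'))"

definition c_is_2cokernel ::
  "('o,'m) acat \<Rightarrow> 'm \<Rightarrow> 'm \<Rightarrow> 'm \<times> 'm \<Rightarrow> 'm \<Rightarrow> 'm \<times> 'm \<Rightarrow> 'm \<Rightarrow> bool" where
  "c_is_2cokernel A a b f c q \<zeta> \<longleftrightarrow>
     c_obj A c \<and> c_mor A b c q \<and> c_cell A a c (c_comp A q f) (c_zero A a c) \<zeta> \<and>
     (\<forall>x. c_obj A x \<longrightarrow>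
        (\<forall>w \<phi>. c_mor A b x w \<and> c_cell A a x (c_comp A w f) (c_zero A a x) \<phi> \<longrightarrow>
           (\<exists>v \<beta>. c_mor A c x v \<and> c_cell A b x (c_comp A v q) w \<beta> \<and>
                  wl A v \<zeta> = Add A (wr A \<beta> f) \<phi>)) \<and>
        (\<forall>v v' \<beta>. c_mor A c x v \<and> c_mor A c x v' \<and> c_cell A b x (c_comp A v q) (c_comp A v' q) \<beta> \<and>
                  wl A v \<zeta> = Add A (wr A \<beta> f) (wl A v' \<zeta>) \<longrightarrow>
           (\<exists>\<gamma>. c_cell A c x v v' \<gamma> \<and> wr A \<gamma> q = \<beta>)) \<and>
        (\<forall>v v' \<gamma> \<gamma>'. c_cell A c x v v' \<gamma> \<and> c_cell A c x v v' \<gamma>' \<and> wr A \<gamma> q = wr A \<gamma>' q \<longrightarrow> \<gamma> = \<gamma>'))"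

text \<open>pip (p, pi) of f : a -> b: pi : 0 => 0 between zero 1-cells p -> a with f pi = id;
  universal: Hom(x,p) -> {rho : 0 => 0 : x -> a | f rho = id} (a discrete groupoid), v |-> pi v,
  is an equivalence.\<close>
definition c_is_pip :: "('o,'m) acat \<Rightarrow> 'm \<Rightarrow> 'm \<Rightarrow> 'm \<times> 'm \<Rightarrow> 'm \<Rightarrow> 'm \<Rightarrow> bool" where
  "c_is_pip A a b f p \<pi> \<longleftrightarrow>
     c_obj A p \<and> c_cell A p a (c_zero A p a) (c_zero A p a) \<pi> \<and> wl A f \<pi> = c_idcell A p b \<and>
     (\<forall>x. c_obj A x \<longrightarrow>
        (\<forall>\<rho>. c_cell A x a (c_zero A x a) (c_zero A x a) \<rho> \<and> wl A f \<rho> = c_idcell A x b \<longrightarrow>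
           (\<exists>v. c_mor A x p v \<and> wr A \<pi> v = \<rho>)) \<and>
        (\<forall>v v'. c_mor A x p v \<and> c_mor A x p v' \<and> wr A \<pi> v = wr A \<pi> v' \<longrightarrow> (\<exists>\<gamma>. c_cell A x p v v' \<gamma>)) \<and>
        (\<forall>v v' \<gamma> \<gamma>'. c_cell A x p v v' \<gamma> \<and> c_cell A x p v v' \<gamma>' \<longrightarrow> \<gamma> = \<gamma>'))"

definition c_is_copip :: "('o,'m) acat \<Rightarrow> 'm \<Rightarrow> 'm \<Rightarrow> 'm \<times> 'm \<Rightarrow> 'm \<Rightarrow> 'm \<Rightarrow> bool" where
  "c_is_copip A a b f p \<pi> \<longleftrightarrow>
     c_obj A p \<and> c_cell A b p (c_zero A b p) (c_zero A b p) \<pi> \<and> wr A \<pi> f = c_idcell A a p \<and>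
     (\<forall>x. c_obj A x \<longrightarrow>
        (\<forall>\<rho>. c_cell A b x (c_zero A b x) (c_zero A b x) \<rho> \<and> wr A \<rho> f = c_idcell A a x \<longrightarrow>
           (\<exists>v. c_mor A p x v \<and> wl A v \<pi> = \<rho>)) \<and>
        (\<forall>v v'. c_mor A p x v \<and> c_mor A p x v' \<and> wl A v \<pi> = wl A v' \<pi> \<longrightarrow> (\<exists>\<gamma>. c_cell A p x v v' \<gamma>)) \<and>
        (\<forall>v v' \<gamma> \<gamma>'. c_cell A p x v v' \<gamma> \<and> c_cell A p x v v' \<gamma>' \<longrightarrow> \<gamma> = \<gamma>'))"

text \<open>root r : R -> a of alpha : 0 => 0 (zero 1-cells a -> b): alpha r = id, and
  Hom(x,R) -> full subgroupoid of Hom(x,a) on {w | alpha w = id}, v |-> r v, is an equivalence.\<close>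
definition c_is_root :: "('o,'m) acat \<Rightarrow> 'm \<Rightarrow> 'm \<Rightarrow> 'm \<Rightarrow> 'm \<Rightarrow> 'm \<times> 'm \<Rightarrow> bool" where
  "c_is_root A a b \<alpha> R r \<longleftrightarrow>
     c_obj A R \<and> c_mor A R a r \<and> wr A \<alpha> r = c_idcell A R b \<and>
     (\<forall>x. c_obj A x \<longrightarrow>
        (\<forall>w. c_mor A x a w \<and> wr A \<alpha> w = c_idcell A x b \<longrightarrow>
           (\<exists>v \<beta>. c_mor A x R v \<and> c_cell A x a (c_comp A r v) w \<beta>)) \<and>
        (\<forall>v v' \<beta>. c_mor A x R v \<and> c_mor A x R v' \<and> c_cell A x a (c_comp A r v) (c_comp A r v') \<beta> \<longrightarrow>
           (\<exists>\<gamma>. c_cell A x R v v' \<gamma> \<and> wl A r \<gamma> = \<beta>)) \<and>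
        (\<forall>v v' \<gamma> \<gamma>'. c_cell A x R v v' \<gamma> \<and> c_cell A x R v v' \<gamma>' \<and> wl A r \<gamma> = wl A r \<gamma>' \<longrightarrow> \<gamma> = \<gamma>'))"

definition c_is_coroot :: "('o,'m) acat \<Rightarrow> 'm \<Rightarrow> 'm \<Rightarrow> 'm \<Rightarrow> 'm \<Rightarrow> 'm \<times> 'm \<Rightarrow> bool" where
  "c_is_coroot A a b \<alpha> Q q \<longleftrightarrow>
     c_obj A Q \<and> c_mor A b Q q \<and> wl A q \<alpha> = c_idcell A a Q \<and>
     (\<forall>x. c_obj A x \<longrightarrow>
        (\<forall>w. c_mor A b x w \<and> wl A w \<alpha> = c_idcell A a x \<longrightarrow>
           (\<exists>v \<beta>. c_mor A Q x v \<and> c_cell A b x (c_comp A v q) w \<beta>)) \<and>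
        (\<forall>v v' \<beta>. c_mor A Q x v \<and> c_mor A Q x v' \<and> c_cell A b x (c_comp A v q) (c_comp A v' q) \<beta> \<longrightarrow>
           (\<exists>\<gamma>. c_cell A Q x v v' \<gamma> \<and> wr A \<gamma> q = \<beta>)) \<and>
        (\<forall>v v' \<gamma> \<gamma>'. c_cell A Q x v v' \<gamma> \<and> c_cell A Q x v v' \<gamma>' \<and> wr A \<gamma> q = wr A \<gamma>' q \<longrightarrow> \<gamma> = \<gamma>'))"

text \<open>2-additivity with respect to the componentwise additive structure: each Hom(a,b) is a
  (strict) symmetric 2-group under c_add (on 2-cells: Add), composition and whiskering are
  bilinear, and there are a zero object and binary biproducts (in the bicategorical sense).\<close>
definition c_two_additive :: "('o,'m) acat \<Rightarrow> bool" where
  "c_two_additive A \<longleftrightarrow>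
     (\<forall>a b. c_obj A a \<and> c_obj A b \<longrightarrow>
        c_mor A a b (c_zero A a b) \<and>
        (\<forall>f g h. c_mor A a b f \<and> c_mor A a b g \<and> c_mor A a b h \<longrightarrow>
           c_mor A a b (c_add A f g) \<and> c_mor A a b (c_neg A f) \<and>
           c_add A (c_add A f g) h = c_add A f (c_add A g h) \<and>
           c_add A f g = c_add A g f \<and>
           c_add A f (c_zero A a b) = f \<and>
           c_add A f (c_neg A f) = c_zero A a b) \<and>
        (\<forall>f g f' g' \<alpha> \<beta>. c_cell A a b f g \<alpha> \<and> c_cell A a b f' g' \<beta> \<longrightarrow>
           c_cell A a b (c_add A f f') (c_add A g g') (Add A \<alpha> \<beta>)) \<and>
        (\<forall>f. c_mor A a b f \<longrightarrow> c_cell A a b f f (c_idcell A a b)) \<and>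
        (\<forall>f g h \<alpha> \<beta>. c_cell A a b f g \<alpha> \<and> c_cell A a b g h \<beta> \<longrightarrow>
           c_cell A a b f h (Add A \<alpha> \<beta>)) \<and>
        (\<forall>f g \<alpha>. c_cell A a b f g \<alpha> \<longrightarrow> c_cell A a b g f (Neg A \<alpha>))) \<and>
     (\<forall>a b c f g h. c_obj A a \<and> c_obj A b \<and> c_obj A c \<and>
        c_mor A a b f \<and> c_mor A a b g \<and> c_mor A b c h \<longrightarrow>
          c_comp A h (c_add A f g) = c_add A (c_comp A h f) (c_comp A h g)) \<and>
     (\<forall>a b c f g h. c_obj A a \<and> c_obj A b \<and> c_obj A c \<and>
        c_mor A b c f \<and> c_mor A b c g \<and> c_mor A a b h \<longrightarrow>
          c_comp A (c_add A f g) h = c_add A (c_comp A f h) (c_comp A g h)) \<and>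
     (\<forall>a b c f g h h' \<alpha> \<beta>. c_obj A a \<and> c_obj A b \<and> c_obj A c \<and>
        c_cell A a b f g \<alpha> \<and> c_cell A a b f g \<beta> \<and> c_mor A b c h \<and> c_mor A b c h' \<longrightarrow>
          wl A h (Add A \<alpha> \<beta>) = Add A (wl A h \<alpha>) (wl A h \<beta>) \<and>
          wl A (c_add A h h') \<alpha> = Add A (wl A h \<alpha>) (wl A h' \<alpha>)) \<and>
     (\<forall>a b c f g h h' \<alpha> \<beta>. c_obj A a \<and> c_obj A b \<and> c_obj A c \<and>
        c_cell A b c f g \<alpha> \<and> c_cell A b c f g \<beta> \<and> c_mor A a b h \<and> c_mor A a b h' \<longrightarrow>
          wr A (Add A \<alpha> \<beta>) h = Add A (wr A \<alpha> h) (wr A \<beta> h) \<and>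
          wr A \<alpha> (c_add A h h') = Add A (wr A \<alpha> h) (wr A \<alpha> h')) \<and>
     (\<exists>z. c_zero_obj A z) \<and>
     (\<forall>a b. c_obj A a \<and> c_obj A b \<longrightarrow>
        (\<exists>s i1 i2 p1 p2 \<alpha>1 \<alpha>2 \<alpha>3 \<alpha>4 \<alpha>5. c_obj A s \<and>
           c_mor A a s i1 \<and> c_mor A b s i2 \<and> c_mor A s a p1 \<and> c_mor A s b p2 \<and>
           c_cell A a a (c_comp A p1 i1) (c_id A a) \<alpha>1 \<and>
           c_cell A b b (c_comp A p2 i2) (c_id A b) \<alpha>2 \<and>
           c_cell A b a (c_comp A p1 i2) (c_zero A b a) \<alpha>3 \<and>
           c_cell A a b (c_comp A p2 i1) (c_zero A a b) \<alpha>4 \<and>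
           c_cell A s s (c_add A (c_comp A i1 p1) (c_comp A i2 p2)) (c_id A s) \<alpha>5))"

definition c_two_abelian :: "('o,'m) acat \<Rightarrow> bool" where
  "c_two_abelian A \<longleftrightarrow> c_two_additive A \<and>
     (\<forall>a b f. c_obj A a \<and> c_obj A b \<and> c_mor A a b f \<longrightarrow>
        (\<exists>k u \<kappa>. c_is_2kernel A a b f k u \<kappa>) \<and>
        (\<exists>c q \<zeta>. c_is_2cokernel A a b f c q \<zeta>) \<and>
        (\<exists>p \<pi>. c_is_pip A a b f p \<pi>) \<and>
        (\<exists>p \<pi>. c_is_copip A a b f p \<pi>)) \<and>
     (\<forall>a b \<alpha>. c_obj A a \<and> c_obj A b \<and> c_cell A a b (c_zero A a b) (c_zero A a b) \<alpha> \<longrightarrow>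
        (\<exists>R r. c_is_root A a b \<alpha> R r) \<and> (\<exists>Q q. c_is_coroot A a b \<alpha> Q q)) \<and>
     \<comment> \<open>2-Puppe-exactness\<close>
     (\<forall>a b f c q \<zeta>. c_faithful A a b f \<and> c_is_2cokernel A a b f c q \<zeta> \<longrightarrow>
        c_is_2kernel A b c q a f \<zeta>) \<and>
     (\<forall>a b f k u \<kappa>. c_cofaithful A a b f \<and> c_is_2kernel A a b f k u \<kappa> \<longrightarrow>
        c_is_2cokernel A k a u b f \<kappa>) \<and>
     (\<forall>a b f p \<pi>. c_fully_faithful A a b f \<and> c_is_copip A a b f p \<pi> \<longrightarrow>
        c_is_root A b p \<pi> a f) \<and>
     (\<forall>a b f p \<pi>. c_fully_cofaithful A a b f \<and> c_is_pip A a b f p \<pi> \<longrightarrow>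
        c_is_coroot A p a \<pi> b f)"

text \<open>The category of discrete objects has as morphisms 2-isomorphism classes of 1-cells.
  A functor out of it is given on representatives (Fm a b f for f : a -> b), constant on 2-iso classes.
  "Equivalent to A via a |-> Coker(a)": Fo a is the codomain of a chosen cokernel cok a of a,
  Fm f is the induced arrow (Fm f o cok a = cok b o f0), Fm is a functor, and it is
  faithful, full and essentially surjective.\<close>
definition discrete_equiv_via_coker :: "('o,'m) acat \<Rightarrow> bool" where
  "discrete_equiv_via_coker A \<longleftrightarrow>
     (\<exists>(cok :: 'm \<Rightarrow> 'm) (Fo :: 'm \<Rightarrow> 'o) (Fm :: 'm \<Rightarrow> 'm \<Rightarrow> 'm \<times> 'm \<Rightarrow> 'm).
        (\<forall>a. c_discrete A a \<longrightarrow> is_cokernel A a (cok a) \<and> Cod A (cok a) = Fo a) \<and>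
        (\<forall>a b f. c_discrete A a \<and> c_discrete A b \<and> c_mor A a b f \<longrightarrow>
           Fm a b f \<in> hom A (Fo a) (Fo b) \<and> Cmp A (Fm a b f) (cok a) = Cmp A (cok b) (fst f)) \<and>
        (\<forall>a b f g \<alpha>. c_discrete A a \<and> c_discrete A b \<and> c_cell A a b f g \<alpha> \<longrightarrow> Fm a b f = Fm a b g) \<and>
        (\<forall>a. c_discrete A a \<longrightarrow> Fm a a (c_id A a) = Idt A (Fo a)) \<and>
        (\<forall>a b c f g. c_discrete A a \<and> c_discrete A b \<and> c_discrete A c \<and>
           c_mor A a b f \<and> c_mor A b c g \<longrightarrow> Fm a c (c_comp A g f) = Cmp A (Fm b c g) (Fm a b f)) \<and>
        (\<forall>a b f g. c_discrete A a \<and> c_discrete A b \<and> c_mor A a b f \<and> c_mor A a b g \<and>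
           Fm a b f = Fm a b g \<longrightarrow> (\<exists>\<alpha>. c_cell A a b f g \<alpha>)) \<and>
        (\<forall>a b h. c_discrete A a \<and> c_discrete A b \<and> h \<in> hom A (Fo a) (Fo b) \<longrightarrow>
           (\<exists>f. c_mor A a b f \<and> Fm a b f = h)) \<and>
        (\<forall>X. \<exists>a. c_discrete A a \<and> isomorphic A (Fo a) X))"

definition codiscrete_equiv_via_ker :: "('o,'m) acat \<Rightarrow> bool" where
  "codiscrete_equiv_via_ker A \<longleftrightarrow>
     (\<exists>(ker :: 'm \<Rightarrow> 'm) (Go :: 'm \<Rightarrow> 'o) (Gm :: 'm \<Rightarrow> 'm \<Rightarrow> 'm \<times> 'm \<Rightarrow> 'm).
        (\<forall>a. c_codiscrete A a \<longrightarrow> is_kernel A a (ker a) \<and> Dom A (ker a) = Go a) \<and>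
        (\<forall>a b f. c_codiscrete A a \<and> c_codiscrete A b \<and> c_mor A a b f \<longrightarrow>
           Gm a b f \<in> hom A (Go a) (Go b) \<and> Cmp A (ker b) (Gm a b f) = Cmp A (snd f) (ker a)) \<and>
        (\<forall>a b f g \<alpha>. c_codiscrete A a \<and> c_codiscrete A b \<and> c_cell A a b f g \<alpha> \<longrightarrow> Gm a b f = Gm a b g) \<and>
        (\<forall>a. c_codiscrete A a \<longrightarrow> Gm a a (c_id A a) = Idt A (Go a)) \<and>
        (\<forall>a b c f g. c_codiscrete A a \<and> c_codiscrete A b \<and> c_codiscrete A c \<and>
           c_mor A a b f \<and> c_mor A b c g \<longrightarrow> Gm a c (c_comp A g f) = Cmp A (Gm b c g) (Gm a b f)) \<and>
        (\<forall>a b f g. c_codiscrete A a \<and> c_codiscrete A b \<and> c_mor A a b f \<and> c_mor A a b g \<and>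
           Gm a b f = Gm a b g \<longrightarrow> (\<exists>\<alpha>. c_cell A a b f g \<alpha>)) \<and>
        (\<forall>a b h. c_codiscrete A a \<and> c_codiscrete A b \<and> h \<in> hom A (Go a) (Go b) \<longrightarrow>
           (\<exists>f. c_mor A a b f \<and> Gm a b f = h)) \<and>
        (\<forall>X. \<exists>a. c_codiscrete A a \<and> isomorphic A (Go a) X))"

end

theory Submission
  imports Defs
begin

text \<open>A null sequence \<open>k \<rightarrow> a \<rightarrow> b\<close>, with \<open>u : k \<rightarrow> a\<close>, \<open>f : a \<rightarrow> b\<close> and a 2-cell \<open>\<kappa>\<close> from \<open>f u\<close> to 0,
  has a total complex \<open>K1 \<rightarrow> K0 \<oplus> A1 \<rightarrow> A0 \<oplus> B1 \<rightarrow> B0\<close>. Its first map is mono iff \<open>u\<close> is faithful, and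
  its last map is epi iff \<open>f\<close> is cofaithful. Testing against the objects \<open>0 \<rightarrow> P\<close> and \<open>X \<rightarrow> 0\<close> shows
  that \<open>(k, u, \<kappa>)\<close> is a 2-kernel of \<open>f\<close> iff the complex is exact with mono first map, and that
  \<open>(b, f, \<kappa>)\<close> is a 2-cokernel of \<open>u\<close> iff it is exact with epi last map. Hence a faithful 1-cell is the
  2-kernel of its 2-cokernel, and a cofaithful one the 2-cokernel of its 2-kernel.
  For \<open>k = 0\<close> the complex is the mapping cone \<open>A1 \<rightarrow> A0 \<oplus> B1 \<rightarrow> B0\<close> of \<open>f\<close>; so \<open>f\<close> is fully faithful iff
  it is a pullback square, and fully cofaithful iff it is a pushout square. Pips and copips prolong the
  cone by an exact step to the left and to the right, which yields the statements on roots and coroots.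
  Limits are formed in the category of all arrows and then pulled back along an epi from a projective
  onto the degree 0 part; colimits keep the degree 0 part and need no such correction.
  An object is discrete iff it is a mono, i.e. the start of a projective presentation of its cokernel,
  and codiscrete iff it is an epi, hence split.\<close>

section \<open>Exactness, pullbacks and duality\<close>

definition opposite :: "('o, 'm) acat \<Rightarrow> ('o, 'm) acat" where
  "opposite A = \<lparr>Dom = Cod A, Cod = Dom A, Cmp = (\<lambda>g f. Cmp A f g), Idt = Idt A,
     Zro = (\<lambda>x y. Zro A y x), Add = Add A, Neg = Neg A\<rparr>"

text \<open>The last condition says that (coker \<open>f\<close>) (ker \<open>g\<close>) = 0; in this form exactness is self-dual and
  needs no images.\<close>
definition is_exact :: "('o, 'm) acat \<Rightarrow> 'm \<Rightarrow> 'm \<Rightarrow> bool" where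
  "is_exact A f g \<longleftrightarrow> Cod A f = Dom A g \<and> Cmp A g f = Zro A (Dom A f) (Cod A g) \<and>
     (\<forall>y z. Cod A y = Dom A g \<and> Cmp A g y = Zro A (Dom A y) (Cod A g) \<and>
        Dom A z = Cod A f \<and> Cmp A z f = Zro A (Dom A f) (Cod A z) \<longrightarrow>
        Cmp A z y = Zro A (Dom A y) (Cod A z))"

definition is_pullback :: "('o, 'm) acat \<Rightarrow> 'm \<Rightarrow> 'm \<Rightarrow> 'm \<Rightarrow> 'm \<Rightarrow> bool" where
  "is_pullback A f g p q \<longleftrightarrow>
     Cod A f = Cod A g \<and> Dom A p = Dom A q \<and> Cod A p = Dom A f \<and> Cod A q = Dom A g \<and>
     Cmp A f p = Cmp A g q \<and>
     (\<forall>x y. Dom A x = Dom A y \<and> Cod A x = Dom A f \<and> Cod A y = Dom A g \<and> Cmp A f x = Cmp A g y \<longrightarrow>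
        (\<exists>!h. h \<in> hom A (Dom A y) (Dom A q) \<and> Cmp A p h = x \<and> Cmp A q h = y))"

definition is_pushout :: "('o, 'm) acat \<Rightarrow> 'm \<Rightarrow> 'm \<Rightarrow> 'm \<Rightarrow> 'm \<Rightarrow> bool" where
  "is_pushout A f g i j \<longleftrightarrow> is_pullback (opposite A) f g i j"

lemma opposite_sel [simp]:
  "Dom (opposite A) = Cod A" "Cod (opposite A) = Dom A" "Cmp (opposite A) g f = Cmp A f g"
  "Idt (opposite A) = Idt A" "Zro (opposite A) x y = Zro A y x"
  "Add (opposite A) = Add A" "Neg (opposite A) = Neg A"
  by (simp_all add: opposite_def)

lemma hom_opposite [simp]: "hom (opposite A) x y = hom A y x"
  by (auto simp: hom_def)

lemma mono_opposite [simp]: "mono (opposite A) f \<longleftrightarrow> epi A f"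
  by (simp add: mono_def epi_def)

lemma epi_opposite [simp]: "epi (opposite A) f \<longleftrightarrow> mono A f"
  by (simp add: mono_def epi_def)

lemma is_kernel_opposite [simp]: "is_kernel (opposite A) f k \<longleftrightarrow> is_cokernel A f k"
  by (simp add: is_kernel_def is_cokernel_def)

lemma is_cokernel_opposite [simp]: "is_cokernel (opposite A) f c \<longleftrightarrow> is_kernel A f c"
  by (simp add: is_kernel_def is_cokernel_def)

lemma is_exact_opposite [simp]: "is_exact (opposite A) g f \<longleftrightarrow> is_exact A f g"
  by (simp add: is_exact_def eq_commute[of "Dom A g"] conj_ac) blast

lemma is_pullback_opposite [simp]: "is_pullback (opposite A) f g i j \<longleftrightarrow> is_pushout A f g i j"
  by (simp add: is_pushout_def)

lemma isomorphic_opposite [simp]: "isomorphic (opposite A) x y \<longleftrightarrow> isomorphic A x y"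
  unfolding isomorphic_def by auto

lemma is_category_opposite: "is_category A \<Longrightarrow> is_category (opposite A)"
  unfolding is_category_def by auto

lemma preadditive_opposite: "preadditive A \<Longrightarrow> preadditive (opposite A)"
  unfolding preadditive_def by auto

lemma has_zero_object_opposite: "has_zero_object A \<Longrightarrow> has_zero_object (opposite A)"
  by (simp add: has_zero_object_def conj_commute)

lemma has_biproducts_opposite: "has_biproducts A \<Longrightarrow> has_biproducts (opposite A)"
  unfolding has_biproducts_def by simp metis

lemma c_mor_opposite [simp]: "c_mor (opposite A) b a f \<longleftrightarrow> c_mor A a b (prod.swap f)"
  by (auto simp: c_mor_def)

lemma c_cell_opposite [simp]:
  "c_cell (opposite A) b a f g \<alpha> \<longleftrightarrow> c_cell A a b (prod.swap f) (prod.swap g) \<alpha>"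
  by (auto simp: c_cell_def msub_def)

section \<open>Preadditive categories\<close>

locale preadditive_category =
  fixes A :: "('o, 'm) acat"
  assumes category: "is_category A" and preadditive: "preadditive A"
begin

abbreviation cmp :: "'m \<Rightarrow> 'm \<Rightarrow> 'm" (infixr "\<cdot>" 70) where "g \<cdot> f \<equiv> Cmp A g f"
abbreviation add :: "'m \<Rightarrow> 'm \<Rightarrow> 'm" (infixl "\<oplus>" 65) where "f \<oplus> g \<equiv> Add A f g"
abbreviation neg :: "'m \<Rightarrow> 'm" ("\<ominus> _" [81] 80) where "\<ominus> f \<equiv> Neg A f"
abbreviation D :: "'m \<Rightarrow> 'o" where "D \<equiv> Dom A"
abbreviation C :: "'m \<Rightarrow> 'o" where "C \<equiv> Cod A"
abbreviation zero :: "'o \<Rightarrow> 'o \<Rightarrow> 'm" ("\<zero>") where "\<zero> \<equiv> Zro A"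
abbreviation I :: "'o \<Rightarrow> 'm" where "I \<equiv> Idt A"
abbreviation arrow :: "'m \<Rightarrow> 'o \<Rightarrow> 'o \<Rightarrow> bool" ("\<guillemotleft>_ : _ \<rightarrow> _\<guillemotright>") where "\<guillemotleft>f : x \<rightarrow> y\<guillemotright> \<equiv> D f = x \<and> C f = y"

lemma opposite_preadditive_category: "preadditive_category (opposite A)"
  using category preadditive is_category_opposite preadditive_opposite by unfold_locales blast+

lemma mem_hom [simp]: "f \<in> hom A x y \<longleftrightarrow> \<guillemotleft>f : x \<rightarrow> y\<guillemotright>"
  by (simp add: hom_def)

lemma cmp_type [simp]: "C f = D g \<Longrightarrow> D (g \<cdot> f) = D f" "C f = D g \<Longrightarrow> C (g \<cdot> f) = C g"
  using category unfolding is_category_def by auto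

lemma id_type [simp]: "D (I x) = x" "C (I x) = x"
  using category unfolding is_category_def by auto

lemma cmp_id [simp]: "D f = x \<Longrightarrow> f \<cdot> I x = f" "C f = x \<Longrightarrow> I x \<cdot> f = f"
  using category unfolding is_category_def by auto

lemma cmp_assoc [simp]: "C f = D g \<Longrightarrow> C g = D h \<Longrightarrow> (h \<cdot> g) \<cdot> f = h \<cdot> g \<cdot> f"
  using category unfolding is_category_def by auto

text \<open>Turns an equation between composites into a rewrite rule for right-nested chains.\<close>
lemma cmp_eq: "g \<cdot> f = k \<Longrightarrow> C f = D g \<Longrightarrow> C z = D f \<Longrightarrow> g \<cdot> f \<cdot> z = k \<cdot> z"
  by auto

lemma zero_type [simp]: "D (\<zero> x y) = x" "C (\<zero> x y) = y"
  using preadditive unfolding preadditive_def by auto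

lemma add_type [simp]:
  "D f = D g \<Longrightarrow> C f = C g \<Longrightarrow> D (f \<oplus> g) = D g"
  "D f = D g \<Longrightarrow> C f = C g \<Longrightarrow> C (f \<oplus> g) = C g"
  using preadditive unfolding preadditive_def by auto

lemma neg_type [simp]: "D (\<ominus> f) = D f" "C (\<ominus> f) = C f"
  using preadditive unfolding preadditive_def by auto

lemma hom_group:
  assumes "f \<in> hom A x y" "g \<in> hom A x y" "h \<in> hom A x y"
  shows "(f \<oplus> g) \<oplus> h = f \<oplus> (g \<oplus> h)" "f \<oplus> g = g \<oplus> f" "f \<oplus> \<zero> x y = f" "f \<oplus> \<ominus> f = \<zero> x y"
  using preadditive assms unfolding preadditive_def by blast+

lemma add_assoc [simp]:
  "D f = D g \<Longrightarrow> C f = C g \<Longrightarrow> D g = D h \<Longrightarrow> C g = C h \<Longrightarrow> (f \<oplus> g) \<oplus> h = f \<oplus> (g \<oplus> h)"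
  by (rule hom_group(1)[of _ "D f" "C f"]) simp_all

lemma add_commute: "D f = D g \<Longrightarrow> C f = C g \<Longrightarrow> f \<oplus> g = g \<oplus> f"
  by (rule hom_group(2)[of _ "D f" "C f" _ f]) simp_all

lemma add_left_commute:
  "D f = D g \<Longrightarrow> C f = C g \<Longrightarrow> D g = D h \<Longrightarrow> C g = C h \<Longrightarrow> f \<oplus> (g \<oplus> h) = g \<oplus> (f \<oplus> h)"
  by (metis add_assoc add_commute)

lemmas add_ac = add_commute add_left_commute

lemma add_zero [simp]:
  "D f = x \<Longrightarrow> C f = y \<Longrightarrow> f \<oplus> \<zero> x y = f"
  "D f = x \<Longrightarrow> C f = y \<Longrightarrow> \<zero> x y \<oplus> f = f"
  using hom_group(3)[of f x y f f] add_commute[of f "\<zero> x y"] by simp_all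

lemma add_neg [simp]: "f \<oplus> \<ominus> f = \<zero> (D f) (C f)" "\<ominus> f \<oplus> f = \<zero> (D f) (C f)"
  using hom_group(4)[of f "D f" "C f" f f] add_commute[of f "\<ominus> f"] by simp_all

lemma add_neg_cancel [simp]:
  "D f = D g \<Longrightarrow> C f = C g \<Longrightarrow> f \<oplus> (\<ominus> f \<oplus> g) = g"
  "D f = D g \<Longrightarrow> C f = C g \<Longrightarrow> \<ominus> f \<oplus> (f \<oplus> g) = g"
  by (simp_all flip: add_assoc)

lemma add_left_cancel [simp]:
  "D f = D g \<Longrightarrow> C f = C g \<Longrightarrow> D h = D g \<Longrightarrow> C h = C g \<Longrightarrow> f \<oplus> g = f \<oplus> h \<longleftrightarrow> g = h"
  by (metis add_neg_cancel(2))

lemma add_right_cancel [simp]: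
  "D f = D g \<Longrightarrow> C f = C g \<Longrightarrow> D h = D g \<Longrightarrow> C h = C g \<Longrightarrow> g \<oplus> f = h \<oplus> f \<longleftrightarrow> g = h"
  by (metis add_left_cancel add_commute)

lemma add_eq_iff_diff:
  assumes "D f = D g" "C f = C g" "D h = D g" "C h = C g"
  shows "f \<oplus> g = h \<longleftrightarrow> f = h \<oplus> \<ominus> g"
  using assms add_right_cancel[of "\<ominus> g" "f \<oplus> g" h] by (simp del: add_right_cancel)

lemma neg_unique: "D f = D g \<Longrightarrow> C f = C g \<Longrightarrow> f \<oplus> g = \<zero> (D f) (C f) \<Longrightarrow> g = \<ominus> f"
  by (metis add_left_cancel add_neg(1) neg_type)

lemma neg_neg [simp]: "\<ominus> (\<ominus> f) = f"
  by (rule neg_unique[symmetric]) simp_all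

lemma neg_zero [simp]: "\<ominus> (\<zero> x y) = \<zero> x y"
  by (rule neg_unique[symmetric]) simp_all

lemma neg_eq_iff [simp]: "\<ominus> f = \<ominus> g \<longleftrightarrow> f = g"
  by (metis neg_neg)

lemma neg_eq_zero_iff [simp]: "\<ominus> f = \<zero> x y \<longleftrightarrow> f = \<zero> x y"
  by (metis neg_neg neg_zero)

lemma neg_eq_swap: "\<ominus> f = g \<longleftrightarrow> f = \<ominus> g"
  by (metis neg_neg)

lemma neg_add [simp]: "D f = D g \<Longrightarrow> C f = C g \<Longrightarrow> \<ominus> (f \<oplus> g) = \<ominus> f \<oplus> \<ominus> g"
  by (rule neg_unique[symmetric]) (simp_all add: add_ac)

lemma add_eq_zero_iff [simp]:
  assumes "D f = x" "C f = y" "D g = x" "C g = y"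
  shows "f \<oplus> g = \<zero> x y \<longleftrightarrow> f = \<ominus> g"
  using assms add_eq_iff_diff[of f g "\<zero> x y"] by simp

lemma msub_eq_iff:
  assumes "D f = D g" "C f = C g" "D h = D g" "C h = C g"
  shows "msub A f g = h \<longleftrightarrow> f = h \<oplus> g"
  using assms add_eq_iff_diff[of f "\<ominus> g" h] by (simp add: msub_def)

lemma cmp_add [simp]:
  assumes "D f = D g" "C f = C g"
  shows cmp_add_left: "D h = C g \<Longrightarrow> h \<cdot> (f \<oplus> g) = h \<cdot> f \<oplus> h \<cdot> g"
    and cmp_add_right: "C k = D g \<Longrightarrow> (f \<oplus> g) \<cdot> k = f \<cdot> k \<oplus> g \<cdot> k"
proof -
  have fg: "f \<in> hom A (D g) (C g)" "g \<in> hom A (D g) (C g)" using assms by simp_all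
  have "h \<cdot> (f \<oplus> g) = h \<cdot> f \<oplus> h \<cdot> g \<and> (f \<oplus> g) \<cdot> k = f \<cdot> k \<oplus> g \<cdot> k"
    if "h \<in> hom A (C g) (C h)" "k \<in> hom A (D k) (D g)" for h k
    using preadditive fg that unfolding preadditive_def by blast
  from this[of h "I (D g)"] this[of "I (C g)" k]
  show "D h = C g \<Longrightarrow> h \<cdot> (f \<oplus> g) = h \<cdot> f \<oplus> h \<cdot> g" "C k = D g \<Longrightarrow> (f \<oplus> g) \<cdot> k = f \<cdot> k \<oplus> g \<cdot> k"
    by simp_all
qed

lemma zero_if_idempotent: "f \<oplus> f = f \<Longrightarrow> f = \<zero> (D f) (C f)"
  by (metis add_neg(2) add_neg_cancel(2))

lemma cmp_zero_right [simp]: assumes "y = D h" shows "h \<cdot> \<zero> x y = \<zero> x (C h)"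
proof -
  have "h \<cdot> \<zero> x y \<oplus> h \<cdot> \<zero> x y = h \<cdot> \<zero> x y" using assms by (simp flip: cmp_add_left)
  from zero_if_idempotent[OF this] show ?thesis using assms by simp
qed

lemma cmp_zero_left [simp]: "x = C h \<Longrightarrow> \<zero> x y \<cdot> h = \<zero> (D h) y"
  using preadditive_category.cmp_zero_right[OF opposite_preadditive_category] by simp

lemma cmp_neg_right [simp]: "C f = D h \<Longrightarrow> h \<cdot> (\<ominus> f) = \<ominus> (h \<cdot> f)"
  by (rule neg_unique) (simp_all flip: cmp_add_left)

lemma cmp_neg_left [simp]: "C h = D f \<Longrightarrow> (\<ominus> f) \<cdot> h = \<ominus> (f \<cdot> h)"
  using preadditive_category.cmp_neg_right[OF opposite_preadditive_category] by simp

lemma monoD: "mono A m \<Longrightarrow> m \<cdot> g = m \<cdot> h \<Longrightarrow> C g = D m \<Longrightarrow> C h = D m \<Longrightarrow> D g = D h \<Longrightarrow> g = h"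
  unfolding mono_def by blast

lemma epiD: "epi A e \<Longrightarrow> g \<cdot> e = h \<cdot> e \<Longrightarrow> D g = C e \<Longrightarrow> D h = C e \<Longrightarrow> C g = C h \<Longrightarrow> g = h"
  unfolding epi_def by blast

lemma monoI:
  assumes "\<And>y. C y = D m \<Longrightarrow> m \<cdot> y = \<zero> (D y) (C m) \<Longrightarrow> y = \<zero> (D y) (D m)"
  shows "mono A m"
  unfolding mono_def
proof (intro allI impI, elim conjE)
  fix g h assume "C g = D m" "C h = D m" "D g = D h" "m \<cdot> g = m \<cdot> h"
  then show "g = h" using assms[of "g \<oplus> \<ominus> h"] by simp
qed

lemma epiI:
  assumes "\<And>y. D y = C e \<Longrightarrow> y \<cdot> e = \<zero> (D e) (C y) \<Longrightarrow> y = \<zero> (C e) (C y)"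
  shows "epi A e"
  using preadditive_category.monoI[OF opposite_preadditive_category, of e] assms by simp

lemma mono_cmp:
  assumes "mono A m" "mono A n" "C n = D m"
  shows "mono A (m \<cdot> n)"
proof (rule monoI)
  fix y assume y: "C y = D (m \<cdot> n)" "(m \<cdot> n) \<cdot> y = \<zero> (D y) (C (m \<cdot> n))"
  then have "n \<cdot> y = \<zero> (D y) (D m)"
    using assms(3) by (intro monoD[OF assms(1), of "n \<cdot> y"]) simp_all
  then show "y = \<zero> (D y) (D (m \<cdot> n))" using assms(3) y(1) by (intro monoD[OF assms(2), of y]) simp_all
qed

lemma projective_lift:
  assumes "epi A e" "projective A (D g)" "C g = C e"
  obtains h where "\<guillemotleft>h : D g \<rightarrow> D e\<guillemotright>" "e \<cdot> h = g"
  using assms unfolding projective_def Bex_def mem_hom by blast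

lemma kernelD:
  assumes "is_kernel A f k"
  shows kernel_type: "C k = D f" and kernel_zero: "f \<cdot> k = \<zero> (D k) (C f)"
  using assms unfolding is_kernel_def by auto

lemma kernel_factor:
  assumes "is_kernel A f k" "C g = D f" "f \<cdot> g = \<zero> (D g) (C f)"
  obtains h where "\<guillemotleft>h : D g \<rightarrow> D k\<guillemotright>" "k \<cdot> h = g"
  using assms unfolding is_kernel_def mem_hom by blast

lemma kernel_mono:
  assumes "is_kernel A f k"
  shows "mono A k"
proof (rule monoI)
  fix y assume y: "C y = D k" "k \<cdot> y = \<zero> (D y) (C k)"
  let ?z = "\<zero> (D y) (C k)"
  have "C ?z = D f \<and> f \<cdot> ?z = \<zero> (D ?z) (C f)" using kernel_type[OF assms] by simp
  then have "\<exists>!h. h \<in> hom A (D ?z) (D k) \<and> k \<cdot> h = ?z" using assms unfolding is_kernel_def by blast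
  moreover have "k \<cdot> \<zero> (D y) (D k) = ?z" by simp
  ultimately show "y = \<zero> (D y) (D k)" using y by (metis mem_hom zero_type)
qed

lemma kernelI:
  assumes "C k = D f" "f \<cdot> k = \<zero> (D k) (C f)" "mono A k"
    and "\<And>g. C g = D f \<Longrightarrow> f \<cdot> g = \<zero> (D g) (C f) \<Longrightarrow> \<exists>h. \<guillemotleft>h : D g \<rightarrow> D k\<guillemotright> \<and> k \<cdot> h = g"
  shows "is_kernel A f k"
  unfolding is_kernel_def
proof (intro conjI allI impI; (elim conjE)?)
  fix g assume "C g = D f" "f \<cdot> g = \<zero> (D g) (C f)"
  then obtain h where h: "\<guillemotleft>h : D g \<rightarrow> D k\<guillemotright>" "k \<cdot> h = g" using assms(4) by blast
  then have "h' = h" if "\<guillemotleft>h' : D g \<rightarrow> D k\<guillemotright>" "k \<cdot> h' = g" for h'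
    using that monoD[OF assms(3), of h' h] by simp
  with h show "\<exists>!h. h \<in> hom A (D g) (D k) \<and> k \<cdot> h = g" unfolding mem_hom by blast
qed (use assms in simp_all)

lemma cokernelD:
  assumes "is_cokernel A f c"
  shows cokernel_type: "D c = C f" and cokernel_zero: "c \<cdot> f = \<zero> (D f) (C c)"
  using assms unfolding is_cokernel_def by auto

lemma cokernel_factor:
  assumes "is_cokernel A f c" "D g = C f" "g \<cdot> f = \<zero> (D f) (C g)"
  obtains h where "\<guillemotleft>h : C c \<rightarrow> C g\<guillemotright>" "h \<cdot> c = g"
  using assms unfolding is_cokernel_def mem_hom by blast

lemma cokernel_epi: "is_cokernel A f c \<Longrightarrow> epi A c"
  using preadditive_category.kernel_mono[OF opposite_preadditive_category, of f c] by simp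

lemma cokernelI:
  assumes "D c = C f" "c \<cdot> f = \<zero> (D f) (C c)" "epi A c"
    and "\<And>g. D g = C f \<Longrightarrow> g \<cdot> f = \<zero> (D f) (C g) \<Longrightarrow> \<exists>h. \<guillemotleft>h : C c \<rightarrow> C g\<guillemotright> \<and> h \<cdot> c = g"
  shows "is_cokernel A f c"
  using preadditive_category.kernelI[OF opposite_preadditive_category, of c f] assms
  by (simp add: conj_commute)

lemma kernels_isomorphic:
  assumes "is_kernel A f k" "is_kernel A f l"
  shows "isomorphic A (D k) (D l)"
proof -
  obtain h where h: "\<guillemotleft>h : D k \<rightarrow> D l\<guillemotright>" "l \<cdot> h = k"
    using kernel_factor[OF assms(2) kernelD[OF assms(1)]] by metis
  obtain g where g: "\<guillemotleft>g : D l \<rightarrow> D k\<guillemotright>" "k \<cdot> g = l"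
    using kernel_factor[OF assms(1) kernelD[OF assms(2)]] by metis
  have "k \<cdot> g \<cdot> h = k \<cdot> I (D k)" using cmp_eq[OF g(2), of h] g h by simp
  then have "g \<cdot> h = I (D k)" by (rule monoD[OF kernel_mono[OF assms(1)]]) (use g h in simp_all)
  moreover have "l \<cdot> h \<cdot> g = l \<cdot> I (D l)" using cmp_eq[OF h(2), of g] g h by simp
  then have "h \<cdot> g = I (D l)" by (rule monoD[OF kernel_mono[OF assms(2)]]) (use g h in simp_all)
  ultimately show ?thesis using g(1) h(1) unfolding isomorphic_def mem_hom by blast
qed

lemma cokernels_isomorphic: "is_cokernel A f c \<Longrightarrow> is_cokernel A f d \<Longrightarrow> isomorphic A (C c) (C d)"
  using preadditive_category.kernels_isomorphic[OF opposite_preadditive_category, of f c d] by simp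

lemma exactD:
  assumes "is_exact A f g"
  shows exact_type: "C f = D g" and exact_zero: "g \<cdot> f = \<zero> (D f) (C g)"
    and exact_cmp_zero: "C y = D g \<Longrightarrow> g \<cdot> y = \<zero> (D y) (C g) \<Longrightarrow> D z = C f \<Longrightarrow> z \<cdot> f = \<zero> (D f) (C z) \<Longrightarrow>
      z \<cdot> y = \<zero> (D y) (C z)"
  using assms unfolding is_exact_def by auto

lemma exact_if_weak_kernel:
  assumes "C f = D g" "g \<cdot> f = \<zero> (D f) (C g)"
    and "\<And>y. C y = D g \<Longrightarrow> g \<cdot> y = \<zero> (D y) (C g) \<Longrightarrow> \<exists>h. \<guillemotleft>h : D y \<rightarrow> D f\<guillemotright> \<and> f \<cdot> h = y"
  shows "is_exact A f g"
  unfolding is_exact_def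
proof (intro conjI allI impI; (elim conjE)?)
  fix y z assume y: "C y = D g" "g \<cdot> y = \<zero> (D y) (C g)" and z: "D z = C f" "z \<cdot> f = \<zero> (D f) (C z)"
  obtain h where "\<guillemotleft>h : D y \<rightarrow> D f\<guillemotright>" "f \<cdot> h = y" using assms(3)[OF y] by blast
  then show "z \<cdot> y = \<zero> (D y) (C z)" using z cmp_eq[OF z(2), of h] by simp
qed (use assms in simp_all)

lemma exact_if_weak_cokernel:
  assumes "C f = D g" "g \<cdot> f = \<zero> (D f) (C g)"
    and "\<And>z. D z = C f \<Longrightarrow> z \<cdot> f = \<zero> (D f) (C z) \<Longrightarrow> \<exists>h. \<guillemotleft>h : C g \<rightarrow> C z\<guillemotright> \<and> h \<cdot> g = z"
  shows "is_exact A f g"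
  using preadditive_category.exact_if_weak_kernel[OF opposite_preadditive_category, of g f] assms
  by (simp add: conj_commute)

lemma kernel_exact: "is_kernel A g f \<Longrightarrow> is_exact A f g"
  by (rule exact_if_weak_kernel) (auto elim: kernelD kernel_factor)

lemma cokernel_exact: "is_cokernel A f g \<Longrightarrow> is_exact A f g"
  using preadditive_category.kernel_exact[OF opposite_preadditive_category, of f g] by simp

lemma pullbackD:
  assumes "is_pullback A f g p q"
  shows pullback_type: "C f = C g" "D p = D q" "C p = D f" "C q = D g"
    and pullback_commutes: "f \<cdot> p = g \<cdot> q"
  using assms unfolding is_pullback_def by auto

lemma pullback_factor:
  assumes "is_pullback A f g p q" "D x = D y" "C x = D f" "C y = D g" "f \<cdot> x = g \<cdot> y"
  obtains h where "\<guillemotleft>h : D y \<rightarrow> D q\<guillemotright>" "p \<cdot> h = x" "q \<cdot> h = y"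
  using assms unfolding is_pullback_def mem_hom by blast

lemma pullback_unique:
  assumes pullback: "is_pullback A f g p q"
    and "C h = D q" "C h' = D q" "D h = D h'" "p \<cdot> h = p \<cdot> h'" "q \<cdot> h = q \<cdot> h'"
  shows "h = h'"
proof -
  note type = pullback_type[OF pullback]
  have "f \<cdot> p \<cdot> h = g \<cdot> q \<cdot> h"
    using type assms(2) cmp_eq[OF pullback_commutes[OF pullback], of h] by simp
  then have "D (p \<cdot> h) = D (q \<cdot> h) \<and> C (p \<cdot> h) = D f \<and> C (q \<cdot> h) = D g \<and> f \<cdot> p \<cdot> h = g \<cdot> q \<cdot> h"
    using type assms(2) by simp
  then have "\<exists>!k. k \<in> hom A (D (q \<cdot> h)) (D q) \<and> p \<cdot> k = p \<cdot> h \<and> q \<cdot> k = q \<cdot> h"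
    using pullback unfolding is_pullback_def by blast
  then show ?thesis using type assms(2-6) by (metis cmp_type(1) mem_hom)
qed

lemma pullbackI:
  assumes "C f = C g" "D p = D q" "C p = D f" "C q = D g" "f \<cdot> p = g \<cdot> q"
    and "\<And>x y. D x = D y \<Longrightarrow> C x = D f \<Longrightarrow> C y = D g \<Longrightarrow> f \<cdot> x = g \<cdot> y \<Longrightarrow>
      \<exists>h. \<guillemotleft>h : D y \<rightarrow> D q\<guillemotright> \<and> p \<cdot> h = x \<and> q \<cdot> h = y"
    and "\<And>h h'. C h = D q \<Longrightarrow> C h' = D q \<Longrightarrow> D h = D h' \<Longrightarrow> p \<cdot> h = p \<cdot> h' \<Longrightarrow> q \<cdot> h = q \<cdot> h' \<Longrightarrow> h = h'"
  shows "is_pullback A f g p q"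
  unfolding is_pullback_def mem_hom using assms by metis

lemma pullback_sym:
  assumes "is_pullback A f g p q"
  shows "is_pullback A g f q p"
proof (rule pullbackI)
  fix x y assume xy: "D x = D y" "C x = D g" "C y = D f" "g \<cdot> x = f \<cdot> y"
  then obtain h where "\<guillemotleft>h : D x \<rightarrow> D q\<guillemotright>" "p \<cdot> h = y" "q \<cdot> h = x"
    using pullback_factor[OF assms, of y x] by auto
  then show "\<exists>h. \<guillemotleft>h : D y \<rightarrow> D p\<guillemotright> \<and> q \<cdot> h = x \<and> p \<cdot> h = y"
    using xy(1) pullback_type(2)[OF assms] by auto
qed (use pullbackD[OF assms] pullback_unique[OF assms] in auto)

lemma
  assumes "is_pushout A f g i j"
  shows pushout_type: "D f = D g" "C i = C j" "D i = C f" "D j = C g"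
    and pushout_commutes: "i \<cdot> f = j \<cdot> g"
  using preadditive_category.pullbackD[OF opposite_preadditive_category, of f g i j] assms by simp_all

lemma pushout_factor:
  assumes "is_pushout A f g i j" "C x = C y" "D x = C f" "D y = C g" "x \<cdot> f = y \<cdot> g"
  obtains h where "\<guillemotleft>h : C j \<rightarrow> C y\<guillemotright>" "h \<cdot> i = x" "h \<cdot> j = y"
  using preadditive_category.pullback_factor[OF opposite_preadditive_category, of f g i j x y] assms
  by auto

lemma pushout_unique:
  assumes "is_pushout A f g i j" "D h = C j" "D h' = C j" "C h = C h'" "h \<cdot> i = h' \<cdot> i" "h \<cdot> j = h' \<cdot> j"
  shows "h = h'"
  using preadditive_category.pullback_unique[OF opposite_preadditive_category, of f g i j h h'] assms
  by simp

lemma pushoutI: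
  assumes "D f = D g" "C i = C j" "D i = C f" "D j = C g" "i \<cdot> f = j \<cdot> g"
    and "\<And>x y. C x = C y \<Longrightarrow> D x = C f \<Longrightarrow> D y = C g \<Longrightarrow> x \<cdot> f = y \<cdot> g \<Longrightarrow>
      \<exists>h. \<guillemotleft>h : C j \<rightarrow> C y\<guillemotright> \<and> h \<cdot> i = x \<and> h \<cdot> j = y"
    and "\<And>h h'. D h = C j \<Longrightarrow> D h' = C j \<Longrightarrow> C h = C h' \<Longrightarrow> h \<cdot> i = h' \<cdot> i \<Longrightarrow> h \<cdot> j = h' \<cdot> j \<Longrightarrow> h = h'"
  shows "is_pushout A f g i j"
  using preadditive_category.pullbackI[OF opposite_preadditive_category, of f g i j] assms
  by (simp add: conj_commute)

end

section \<open>Additive categories and matrices\<close>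

locale additive_category = preadditive_category A for A :: "('o, 'm) acat" +
  assumes zero_object: "has_zero_object A" and biproducts: "has_biproducts A"
begin

lemma opposite_additive_category: "additive_category (opposite A)"
  using opposite_preadditive_category zero_object biproducts
  by (simp add: additive_category_def additive_category_axioms_def has_zero_object_opposite
      has_biproducts_opposite)

definition Z :: 'o where
  "Z = (SOME z. \<forall>x. (\<exists>!f. f \<in> hom A z x) \<and> (\<exists>!f. f \<in> hom A x z))"

lemma Z_opposite: "additive_category.Z (opposite A) = Z"
  by (simp add: additive_category.Z_def[OF opposite_additive_category] Z_def conj_commute)

lemma from_Z_unique:
  assumes "D f = Z" "D g = Z" "C f = C g"
  shows "f = g"
proof -
  have "\<exists>!h. h \<in> hom A Z (C f)"
    using someI_ex[OF zero_object[unfolded has_zero_object_def]] unfolding Z_def by blast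
  with assms show ?thesis by (metis mem_hom)
qed

lemma epi_to_Z: "epi A (\<zero> X Z)"
  by (rule epiI) (rule from_Z_unique, simp_all)

definition is_biproduct :: "'o \<Rightarrow> 'o \<Rightarrow> 'o \<times> 'm \<times> 'm \<times> 'm \<times> 'm \<Rightarrow> bool" where
  "is_biproduct x y = (\<lambda>(s, i1, i2, p1, p2).
     \<guillemotleft>i1 : x \<rightarrow> s\<guillemotright> \<and> \<guillemotleft>i2 : y \<rightarrow> s\<guillemotright> \<and> \<guillemotleft>p1 : s \<rightarrow> x\<guillemotright> \<and> \<guillemotleft>p2 : s \<rightarrow> y\<guillemotright> \<and>
     p1 \<cdot> i1 = I x \<and> p2 \<cdot> i2 = I y \<and> p1 \<cdot> i2 = \<zero> y x \<and> p2 \<cdot> i1 = \<zero> x y \<and> i1 \<cdot> p1 \<oplus> i2 \<cdot> p2 = I s)"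

definition biproduct :: "'o \<Rightarrow> 'o \<Rightarrow> 'o \<times> 'm \<times> 'm \<times> 'm \<times> 'm" where
  "biproduct x y = (SOME t. is_biproduct x y t)"

definition bsum :: "'o \<Rightarrow> 'o \<Rightarrow> 'o" (infixr "\<boxplus>" 65) where "x \<boxplus> y = fst (biproduct x y)"
definition in1 :: "'o \<Rightarrow> 'o \<Rightarrow> 'm" where "in1 x y = fst (snd (biproduct x y))"
definition in2 :: "'o \<Rightarrow> 'o \<Rightarrow> 'm" where "in2 x y = fst (snd (snd (biproduct x y)))"
definition pr1 :: "'o \<Rightarrow> 'o \<Rightarrow> 'm" where "pr1 x y = fst (snd (snd (snd (biproduct x y))))"
definition pr2 :: "'o \<Rightarrow> 'o \<Rightarrow> 'm" where "pr2 x y = snd (snd (snd (snd (biproduct x y))))"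

lemma is_biproduct_bsum: "is_biproduct x y (x \<boxplus> y, in1 x y, in2 x y, pr1 x y, pr2 x y)"
proof -
  have "\<exists>t. is_biproduct x y t"
    using biproducts unfolding has_biproducts_def is_biproduct_def mem_hom by auto
  then show ?thesis
    unfolding bsum_def in1_def in2_def pr1_def pr2_def biproduct_def prod.collapse by (rule someI_ex)
qed

lemma biproduct_type [simp]:
  "D (in1 x y) = x" "C (in1 x y) = x \<boxplus> y" "D (in2 x y) = y" "C (in2 x y) = x \<boxplus> y"
  "D (pr1 x y) = x \<boxplus> y" "C (pr1 x y) = x" "D (pr2 x y) = x \<boxplus> y" "C (pr2 x y) = y"
  using is_biproduct_bsum[of x y] by (simp_all add: is_biproduct_def)

lemma pr_in [simp]:
  "pr1 x y \<cdot> in1 x y = I x" "pr2 x y \<cdot> in2 x y = I y"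
  "pr1 x y \<cdot> in2 x y = \<zero> y x" "pr2 x y \<cdot> in1 x y = \<zero> x y"
  using is_biproduct_bsum[of x y] by (simp_all add: is_biproduct_def)

lemma in_pr: "in1 x y \<cdot> pr1 x y \<oplus> in2 x y \<cdot> pr2 x y = I (x \<boxplus> y)"
  using is_biproduct_bsum[of x y] by (simp add: is_biproduct_def)

definition pair :: "'m \<Rightarrow> 'm \<Rightarrow> 'm" (infixr "\<triangle>" 67) where
  "f \<triangle> g = in1 (C f) (C g) \<cdot> f \<oplus> in2 (C f) (C g) \<cdot> g"

definition copair :: "'m \<Rightarrow> 'm \<Rightarrow> 'm" (infixr "\<nabla>" 67) where
  "f \<nabla> g = f \<cdot> pr1 (D f) (D g) \<oplus> g \<cdot> pr2 (D f) (D g)"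

lemma pair_type [simp]: "D f = D g \<Longrightarrow> D (f \<triangle> g) = D g" "D f = D g \<Longrightarrow> C (f \<triangle> g) = C f \<boxplus> C g"
  by (simp_all add: pair_def)

lemma copair_type [simp]: "C f = C g \<Longrightarrow> D (f \<nabla> g) = D f \<boxplus> D g" "C f = C g \<Longrightarrow> C (f \<nabla> g) = C g"
  by (simp_all add: copair_def)

lemma pr_pair [simp]:
  assumes "D f = D g" "C f = x" "C g = y"
  shows "pr1 x y \<cdot> (f \<triangle> g) = f" "pr2 x y \<cdot> (f \<triangle> g) = g"
  using assms pr_in[of x y, THEN cmp_eq] by (simp_all add: pair_def)

lemma copair_in [simp]:
  assumes "C f = C g" "D f = x" "D g = y"
  shows "(f \<nabla> g) \<cdot> in1 x y = f" "(f \<nabla> g) \<cdot> in2 x y = g"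
  using assms by (simp_all add: copair_def)

lemma pair_cmp [simp]: "D f = D g \<Longrightarrow> C h = D g \<Longrightarrow> (f \<triangle> g) \<cdot> h = f \<cdot> h \<triangle> g \<cdot> h"
  by (simp add: pair_def)

lemma cmp_copair [simp]: "C f = C g \<Longrightarrow> D h = C g \<Longrightarrow> h \<cdot> (f \<nabla> g) = h \<cdot> f \<nabla> h \<cdot> g"
  by (simp add: copair_def)

lemma copair_pair [simp]:
  assumes "C h = C k" "D f = D g" "C f = D h" "C g = D k"
  shows "(h \<nabla> k) \<cdot> (f \<triangle> g) = h \<cdot> f \<oplus> k \<cdot> g"
  using assms by (simp add: copair_def)

lemma pair_eq_iff [simp]:
  assumes "D f = D g" "D h = D k" "C f = C h" "C g = C k"
  shows "f \<triangle> g = h \<triangle> k \<longleftrightarrow> f = h \<and> g = k"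
  using assms pr_pair by metis

lemma copair_eq_iff [simp]:
  assumes "C f = C g" "C h = C k" "D f = D h" "D g = D k"
  shows "f \<nabla> g = h \<nabla> k \<longleftrightarrow> f = h \<and> g = k"
  using assms copair_in by metis

lemma pair_zero [simp]: "\<zero> w x \<triangle> \<zero> w y = \<zero> w (x \<boxplus> y)"
  by (simp add: pair_def)

lemma copair_zero [simp]: "\<zero> x w \<nabla> \<zero> y w = \<zero> (x \<boxplus> y) w"
  by (simp add: copair_def)

lemma pair_eq_zero_iff [simp]:
  assumes "D f = w" "D g = w" "C f = x" "C g = y"
  shows "f \<triangle> g = \<zero> w (x \<boxplus> y) \<longleftrightarrow> f = \<zero> w x \<and> g = \<zero> w y"
  using assms pair_eq_iff[of f g "\<zero> w x" "\<zero> w y"] by simp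

lemma copair_eq_zero_iff [simp]:
  assumes "C f = w" "C g = w" "D f = x" "D g = y"
  shows "f \<nabla> g = \<zero> (x \<boxplus> y) w \<longleftrightarrow> f = \<zero> x w \<and> g = \<zero> y w"
  using assms copair_eq_iff[of f g "\<zero> x w" "\<zero> y w"] by simp

lemma pair_add [simp]:
  assumes "D f = D g" "D h = D g" "D k = D g" "C h = C f" "C k = C g"
  shows "(f \<triangle> g) \<oplus> (h \<triangle> k) = (f \<oplus> h) \<triangle> (g \<oplus> k)"
  using assms by (simp add: pair_def add_ac)

lemma copair_add [simp]:
  assumes "C f = C g" "C h = C g" "C k = C g" "D h = D f" "D k = D g"
  shows "(f \<nabla> g) \<oplus> (h \<nabla> k) = (f \<oplus> h) \<nabla> (g \<oplus> k)"
  using assms by (simp add: copair_def add_ac)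

lemma neg_pair [simp]: "D f = D g \<Longrightarrow> \<ominus> (f \<triangle> g) = \<ominus> f \<triangle> \<ominus> g"
  by (simp add: pair_def)

lemma pair_cases:
  assumes "C h = x \<boxplus> y"
  obtains f g where "D f = D g" "C f = x" "C g = y" "h = f \<triangle> g"
proof (rule that)
  have "h = (in1 x y \<cdot> pr1 x y \<oplus> in2 x y \<cdot> pr2 x y) \<cdot> h" using assms by (simp add: in_pr)
  then show "h = pr1 x y \<cdot> h \<triangle> pr2 x y \<cdot> h" using assms by (simp add: pair_def)
qed (use assms in simp_all)

lemma copair_cases:
  assumes "D h = x \<boxplus> y"
  obtains f g where "D f = x" "D g = y" "C f = C g" "h = f \<nabla> g"
proof (rule that)
  have "h = h \<cdot> (in1 x y \<cdot> pr1 x y \<oplus> in2 x y \<cdot> pr2 x y)" using assms by (simp add: in_pr)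
  then show "h = h \<cdot> in1 x y \<nabla> h \<cdot> in2 x y" using assms by (simp add: copair_def)
qed (use assms in simp_all)

lemma copair_pair_interchange:
  assumes "D f = D g" "D h = D k" "C f = C h" "C g = C k"
  shows "(f \<triangle> g) \<nabla> (h \<triangle> k) = (f \<nabla> h) \<triangle> (g \<nabla> k)"
  using assms by (simp add: pair_def copair_def add_ac)

lemma pullback_iff_kernel:
  assumes "C f = C g" "D p = D q" "C p = D f" "C q = D g"
  shows "is_pullback A f g p q \<longleftrightarrow> is_kernel A (f \<nabla> \<ominus> g) (p \<triangle> q)"
proof
  assume pullback: "is_pullback A f g p q"
  show "is_kernel A (f \<nabla> \<ominus> g) (p \<triangle> q)"
  proof (rule kernelI)
    show "(f \<nabla> \<ominus> g) \<cdot> (p \<triangle> q) = \<zero> (D (p \<triangle> q)) (C (f \<nabla> \<ominus> g))"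
      using assms pullback_commutes[OF pullback] by simp
    show "mono A (p \<triangle> q)"
      by (rule monoI, rule pullback_unique[OF pullback]) (use assms in simp_all)
    fix w assume w: "C w = D (f \<nabla> \<ominus> g)" "(f \<nabla> \<ominus> g) \<cdot> w = \<zero> (D w) (C (f \<nabla> \<ominus> g))"
    then obtain x y where xy: "D x = D y" "C x = D f" "C y = D g" "w = x \<triangle> y"
      using pair_cases[of w "D f" "D g"] assms by auto
    then obtain h where "\<guillemotleft>h : D y \<rightarrow> D q\<guillemotright>" "p \<cdot> h = x" "q \<cdot> h = y"
      using pullback_factor[OF pullback, of x y] w assms by auto
    then show "\<exists>h. \<guillemotleft>h : D w \<rightarrow> D (p \<triangle> q)\<guillemotright> \<and> (p \<triangle> q) \<cdot> h = w"
      using xy assms by (intro exI[of _ h]) simp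
  qed (use assms in simp_all)
next
  assume kernel: "is_kernel A (f \<nabla> \<ominus> g) (p \<triangle> q)"
  show "is_pullback A f g p q"
  proof (rule pullbackI)
    show "f \<cdot> p = g \<cdot> q" using kernel_zero[OF kernel] assms by simp
    show "h = h'" if "C h = D q" "C h' = D q" "D h = D h'" "p \<cdot> h = p \<cdot> h'" "q \<cdot> h = q \<cdot> h'" for h h'
      by (rule monoD[OF kernel_mono[OF kernel]]) (use that assms in simp_all)
    fix x y assume xy: "D x = D y" "C x = D f" "C y = D g" "f \<cdot> x = g \<cdot> y"
    then obtain h where h: "\<guillemotleft>h : D (x \<triangle> y) \<rightarrow> D (p \<triangle> q)\<guillemotright>" "(p \<triangle> q) \<cdot> h = x \<triangle> y"
      using kernel_factor[OF kernel, of "x \<triangle> y"] assms by auto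
    then show "\<exists>h. \<guillemotleft>h : D y \<rightarrow> D q\<guillemotright> \<and> p \<cdot> h = x \<and> q \<cdot> h = y"
      using xy assms by (intro exI[of _ h]) simp
  qed (use assms in simp_all)
qed

lemma pushout_iff_cokernel:
  assumes "D f = D g" "C i = C j" "D i = C f" "D j = C g"
  shows "is_pushout A f g i j \<longleftrightarrow> is_cokernel A (f \<triangle> g) (i \<nabla> \<ominus> j)"
proof
  assume pushout: "is_pushout A f g i j"
  show "is_cokernel A (f \<triangle> g) (i \<nabla> \<ominus> j)"
  proof (rule cokernelI)
    show "(i \<nabla> \<ominus> j) \<cdot> (f \<triangle> g) = \<zero> (D (f \<triangle> g)) (C (i \<nabla> \<ominus> j))"
      using assms pushout_commutes[OF pushout] by simp
    show "epi A (i \<nabla> \<ominus> j)"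
      by (rule epiI, rule pushout_unique[OF pushout]) (use assms in simp_all)
    fix w assume w: "D w = C (f \<triangle> g)" "w \<cdot> (f \<triangle> g) = \<zero> (D (f \<triangle> g)) (C w)"
    then obtain x y where xy: "D x = C f" "D y = C g" "C x = C y" "w = x \<nabla> y"
      using copair_cases[of w "C f" "C g"] assms by auto
    then obtain h where "\<guillemotleft>h : C j \<rightarrow> C y\<guillemotright>" "h \<cdot> i = x" "h \<cdot> j = \<ominus> y"
      using pushout_factor[OF pushout, of x "\<ominus> y"] w assms by auto
    then show "\<exists>h. \<guillemotleft>h : C (i \<nabla> \<ominus> j) \<rightarrow> C w\<guillemotright> \<and> h \<cdot> (i \<nabla> \<ominus> j) = w"
      using xy assms by (intro exI[of _ h]) simp
  qed (use assms in simp_all)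
next
  assume cokernel: "is_cokernel A (f \<triangle> g) (i \<nabla> \<ominus> j)"
  show "is_pushout A f g i j"
  proof (rule pushoutI)
    show "i \<cdot> f = j \<cdot> g" using cokernel_zero[OF cokernel] assms by simp
    show "h = h'" if "D h = C j" "D h' = C j" "C h = C h'" "h \<cdot> i = h' \<cdot> i" "h \<cdot> j = h' \<cdot> j" for h h'
      by (rule epiD[OF cokernel_epi[OF cokernel]]) (use that assms in simp_all)
    fix x y assume xy: "C x = C y" "D x = C f" "D y = C g" "x \<cdot> f = y \<cdot> g"
    then obtain h where h: "\<guillemotleft>h : C (i \<nabla> \<ominus> j) \<rightarrow> C (x \<nabla> \<ominus> y)\<guillemotright>" "h \<cdot> (i \<nabla> \<ominus> j) = x \<nabla> \<ominus> y"
      using cokernel_factor[OF cokernel, of "x \<nabla> \<ominus> y"] assms by auto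
    then show "\<exists>h. \<guillemotleft>h : C j \<rightarrow> C y\<guillemotright> \<and> h \<cdot> i = x \<and> h \<cdot> j = y"
      using xy assms by (intro exI[of _ h]) simp
  qed (use assms in simp_all)
qed

lemma exact_copair:
  assumes "is_exact A p g" "C m = C p" "g \<cdot> m = \<zero> (D m) (C g)"
  shows "is_exact A (p \<nabla> m) g"
  unfolding is_exact_def
proof (intro conjI allI impI; (elim conjE)?)
  fix y z assume "C y = D g" "g \<cdot> y = \<zero> (D y) (C g)"
    "D z = C (p \<nabla> m)" "z \<cdot> (p \<nabla> m) = \<zero> (D (p \<nabla> m)) (C z)"
  then show "z \<cdot> y = \<zero> (D y) (C z)" using exact_cmp_zero[OF assms(1), of y z] assms(2) by simp
qed (use assms exactD(1,2)[OF assms(1)] in simp_all)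

lemma exact_pair:
  assumes "is_exact A f q" "D m = D q" "m \<cdot> f = \<zero> (D f) (C m)"
  shows "is_exact A f (m \<triangle> q)"
  unfolding is_exact_def
proof (intro conjI allI impI; (elim conjE)?)
  fix y z assume "C y = D (m \<triangle> q)" "(m \<triangle> q) \<cdot> y = \<zero> (D y) (C (m \<triangle> q))"
    "D z = C f" "z \<cdot> f = \<zero> (D f) (C z)"
  then show "z \<cdot> y = \<zero> (D y) (C z)" using exact_cmp_zero[OF assms(1), of y z] assms(2) by simp
qed (use assms exactD(1,2)[OF assms(1)] in simp_all)

end

section \<open>Abelian categories\<close>

locale abelian_category = additive_category A for A :: "('o, 'm) acat" +
  assumes ex_kernel: "\<exists>k. is_kernel A f k"
    and ex_cokernel: "\<exists>c. is_cokernel A f c"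
    and mono_normal: "mono A m \<Longrightarrow> \<exists>f. is_kernel A f m"
    and epi_normal: "epi A e \<Longrightarrow> \<exists>f. is_cokernel A f e"
begin

lemma opposite_abelian_category: "abelian_category (opposite A)"
  using opposite_additive_category ex_kernel ex_cokernel mono_normal epi_normal
  by (simp add: abelian_category_def abelian_category_axioms_def)

lemma epi_is_cokernel:
  assumes "epi A e" "is_kernel A e n"
  shows "is_cokernel A n e"
proof (rule cokernelI)
  obtain f where f: "is_cokernel A f e" using epi_normal[OF assms(1)] by blast
  note n = kernelD[OF assms(2)]
  obtain f' where f': "\<guillemotleft>f' : D f \<rightarrow> D n\<guillemotright>" "n \<cdot> f' = f"
    using kernel_factor[OF assms(2), of f] cokernelD[OF f] by metis
  fix g assume g: "D g = C n" "g \<cdot> n = \<zero> (D n) (C g)"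
  then have "g \<cdot> f = \<zero> (D f) (C g)" using cmp_eq[OF g(2), of f'] f' by simp
  then show "\<exists>h. \<guillemotleft>h : C e \<rightarrow> C g\<guillemotright> \<and> h \<cdot> e = g"
    using cokernel_factor[OF f, of g] g(1) n(1) cokernel_type[OF f] by metis
qed (use assms kernelD[OF assms(2)] in simp_all)

lemma mono_is_kernel: "mono A m \<Longrightarrow> is_cokernel A m c \<Longrightarrow> is_kernel A c m"
  using abelian_category.epi_is_cokernel[OF opposite_abelian_category, of m c] by simp

lemma exact_mono_is_kernel:
  assumes "is_exact A f g" "mono A f"
  shows "is_kernel A g f"
proof (rule kernelI)
  obtain c where c: "is_cokernel A f c" using ex_cokernel by blast
  note cD = cokernelD[OF c]
  fix y assume y: "C y = D g" "g \<cdot> y = \<zero> (D y) (C g)"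
  then have "c \<cdot> y = \<zero> (D y) (C c)" by (rule exact_cmp_zero[OF assms(1)]) (use cD in simp_all)
  then show "\<exists>h. \<guillemotleft>h : D y \<rightarrow> D f\<guillemotright> \<and> f \<cdot> h = y"
    using kernel_factor[OF mono_is_kernel[OF assms(2) c], of y] y(1) cD(1) exact_type[OF assms(1)]
    by metis
qed (use assms exactD(1,2)[OF assms(1)] in simp_all)

lemma exact_epi_is_cokernel: "is_exact A f g \<Longrightarrow> epi A g \<Longrightarrow> is_cokernel A f g"
  using abelian_category.exact_mono_is_kernel[OF opposite_abelian_category, of g f] by simp

text \<open>If the corestriction \<open>e\<close> of \<open>f\<close> to its image \<open>m\<close> factored through a proper subobject \<open>n\<close>, then \<open>f\<close>
  would be killed by the cokernel of \<open>m \<cdot> n\<close>, which does not kill \<open>m\<close>.\<close>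
lemma image_factorization:
  assumes c: "is_cokernel A f c" and m: "is_kernel A c m"
  obtains e where "\<guillemotleft>e : D f \<rightarrow> D m\<guillemotright>" "m \<cdot> e = f" "epi A e"
proof -
  note cD = cokernelD[OF c] and mD = kernelD[OF m]
  obtain e where e: "\<guillemotleft>e : D f \<rightarrow> D m\<guillemotright>" "m \<cdot> e = f" using kernel_factor[OF m, of f] cD by metis
  have "epi A e"
  proof (rule epiI)
    fix z assume z: "D z = C e" "z \<cdot> e = \<zero> (D e) (C z)"
    obtain n where n: "is_kernel A z n" using ex_kernel by blast
    note nD = kernelD[OF n]
    obtain e' where e': "\<guillemotleft>e' : D f \<rightarrow> D n\<guillemotright>" "n \<cdot> e' = e" using kernel_factor[OF n, of e] z e by metis
    have mn: "mono A (m \<cdot> n)" using mono_cmp kernel_mono m n nD(1) z(1) e by simp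
    obtain h where h: "is_cokernel A (m \<cdot> n) h" using ex_cokernel by blast
    have hD: "D h = C m" "h \<cdot> m \<cdot> n = \<zero> (D n) (C h)" using cokernelD[OF h] nD(1) z(1) e by simp_all
    have "h \<cdot> m \<cdot> e = h \<cdot> (m \<cdot> n) \<cdot> e'" using e' nD(1) z(1) e(1) by simp
    also have "\<dots> = \<zero> (D f) (C h)" using cmp_eq[OF hD(2), of e'] hD e' nD(1) z(1) e(1) by simp
    finally have "h \<cdot> f = \<zero> (D f) (C h)" using e(2) by simp
    then obtain h' where h': "\<guillemotleft>h' : C c \<rightarrow> C h\<guillemotright>" "h' \<cdot> c = h"
      using cokernel_factor[OF c, of h] hD(1) mD(1) cD(1) by metis
    have "h \<cdot> m = \<zero> (D m) (C h)" using cmp_eq[OF h'(2), of m] h'(1) mD by simp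
    then obtain t where t: "\<guillemotleft>t : D m \<rightarrow> D n\<guillemotright>" "(m \<cdot> n) \<cdot> t = m"
      using kernel_factor[OF mono_is_kernel[OF mn h], of m] hD(1) nD(1) z(1) e(1) by auto
    have "m \<cdot> n \<cdot> t = m \<cdot> I (D m)" using t nD(1) z(1) e(1) by simp
    then have "n \<cdot> t = I (D m)"
      by (rule monoD[OF kernel_mono[OF m]]) (use t nD(1) z(1) e(1) in simp_all)
    then have "z = z \<cdot> n \<cdot> t" using z(1) e(1) by simp
    also have "\<dots> = \<zero> (C e) (C z)" using cmp_eq[OF nD(2), of t] t nD(1) z(1) e(1) by simp
    finally show "z = \<zero> (C e) (C z)" .
  qed
  with e that show thesis by blast
qed

lemma ex_pullback:
  assumes "C f = C g"
  obtains p q where "is_pullback A f g p q"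
proof -
  obtain k where k: "is_kernel A (f \<nabla> \<ominus> g) k" using ex_kernel by blast
  obtain p q where "D p = D q" "C p = D f" "C q = D g" "k = p \<triangle> q"
    using pair_cases[of k "D f" "D g"] kernel_type[OF k] assms by auto
  then have "is_pullback A f g p q" using k assms by (simp add: pullback_iff_kernel)
  then show thesis by (rule that)
qed

lemma ex_pushout:
  assumes "D f = D g"
  obtains i j where "is_pushout A f g i j"
  using abelian_category.ex_pullback[OF opposite_abelian_category, of f g] assms by auto

text \<open>Since \<open>C g\<close> is projective, \<open>g\<close> splits, so its kernel, the image of \<open>f\<close>, is a direct summand.\<close>
lemma extend_along_exact:
  assumes ef: "is_exact A e f" and fg: "is_exact A f g" and g: "epi A g" "projective A (C g)"
    and h: "D h = D f" "h \<cdot> e = \<zero> (D e) (C h)"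
  obtains h' where "\<guillemotleft>h' : C f \<rightarrow> C h\<guillemotright>" "h' \<cdot> f = h"
proof -
  note fgD = exactD(1,2)[OF fg] and efD = exactD(1,2)[OF ef]
  obtain s where s: "\<guillemotleft>s : C g \<rightarrow> D g\<guillemotright>" "g \<cdot> s = I (C g)"
    using projective_lift[OF g(1), of "I (C g)"] g(2) by auto
  obtain n where n: "is_kernel A g n" using ex_kernel by blast
  note nD = kernelD[OF n]
  obtain d where d: "\<guillemotleft>d : D f \<rightarrow> D n\<guillemotright>" "n \<cdot> d = f" using kernel_factor[OF n, of f] fgD by metis
  have "g \<cdot> (I (D g) \<oplus> \<ominus> (s \<cdot> g)) = \<zero> (D g) (C g)" using s cmp_eq[OF s(2), of g] by simp
  then obtain r where r: "\<guillemotleft>r : D g \<rightarrow> D n\<guillemotright>" "n \<cdot> r = I (D g) \<oplus> \<ominus> (s \<cdot> g)"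
    using kernel_factor[OF n, of "I (D g) \<oplus> \<ominus> (s \<cdot> g)"] s(1) by auto
  have "n \<cdot> r \<cdot> n = n \<cdot> I (D n)" using cmp_eq[OF r(2), of n] r(1) nD s(1) by simp
  then have rn: "r \<cdot> n = I (D n)" by (rule monoD[OF kernel_mono[OF n]]) (use r(1) nD in simp_all)
  have "epi A d"
  proof (rule epiI)
    fix z assume z: "D z = C d" "z \<cdot> d = \<zero> (D d) (C z)"
    have "(z \<cdot> r) \<cdot> n \<cdot> d = \<zero> (D f) (C z)" using cmp_eq[OF rn, of d] d(1) r(1) z nD(1) by simp
    then have "(z \<cdot> r) \<cdot> f = \<zero> (D f) (C (z \<cdot> r))" using d r(1) z(1) by simp
    then have "(z \<cdot> r) \<cdot> n = \<zero> (D n) (C (z \<cdot> r))"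
      using exact_cmp_zero[OF fg, of n "z \<cdot> r"] nD d(1) r(1) z(1) fgD(1) by simp
    then show "z = \<zero> (C d) (C z)" using rn r(1) d(1) z(1) nD(1) by simp
  qed
  moreover obtain k where k: "is_kernel A d k" using ex_kernel by blast
  ultimately have d_coker: "is_cokernel A k d" by (rule epi_is_cokernel)
  have "f \<cdot> k = \<zero> (D k) (C f)" using cmp_eq[OF d(2), of k] d(1) kernelD[OF k] nD(1) fgD(1) by simp
  then have "h \<cdot> k = \<zero> (D k) (C h)"
    using exact_cmp_zero[OF ef, of k h] kernelD(1)[OF k] d(1) h efD(1) by simp
  then obtain h'' where h'': "\<guillemotleft>h'' : D n \<rightarrow> C h\<guillemotright>" "h'' \<cdot> d = h"
    using cokernel_factor[OF d_coker, of h] h(1) kernelD(1)[OF k] d(1) by metis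
  have "(h'' \<cdot> r) \<cdot> n \<cdot> d = h" using cmp_eq[OF rn, of d] d(1) r(1) h'' nD(1) by simp
  then have "(h'' \<cdot> r) \<cdot> f = h" using d(2) by simp
  then show thesis using that[of "h'' \<cdot> r"] h''(1) r(1) fgD(1) by simp
qed

end

section \<open>Enough projectives\<close>

locale abelian_with_projectives = abelian_category A for A :: "('o, 'm) acat" +
  assumes enough: "enough_projectives A"
begin

lemma projective_cover:
  obtains e where "projective A (D e)" "epi A e" "C e = X"
  using enough unfolding enough_projectives_def mem_hom by blast

lemma projective_Z: "projective A Z"
  unfolding projective_def
proof (intro allI impI, elim conjE)
  fix e g assume "g \<in> hom A Z (C e)"
  then show "\<exists>h\<in>hom A Z (D e). e \<cdot> h = g"
    by (intro bexI[of _ "\<zero> Z (D e)"] from_Z_unique) simp_all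
qed

lemma projective_bsum:
  assumes "projective A x" "projective A y"
  shows "projective A (x \<boxplus> y)"
  unfolding projective_def
proof (intro allI impI, elim conjE)
  fix e g assume e: "epi A e" and g: "g \<in> hom A (x \<boxplus> y) (C e)"
  then obtain g1 g2 where gs: "D g1 = x" "D g2 = y" "C g1 = C g2" "g = g1 \<nabla> g2"
    using copair_cases[of g x y] by auto
  have C_g: "C g2 = C e" using g gs by simp
  obtain h1 where "\<guillemotleft>h1 : x \<rightarrow> D e\<guillemotright>" "e \<cdot> h1 = g1"
    using projective_lift[OF e, of g1] gs C_g assms by auto
  moreover obtain h2 where "\<guillemotleft>h2 : y \<rightarrow> D e\<guillemotright>" "e \<cdot> h2 = g2"
    using projective_lift[OF e, of g2] gs C_g assms by auto
  ultimately show "\<exists>h\<in>hom A (x \<boxplus> y) (D e). e \<cdot> h = g"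
    using gs by (intro bexI[of _ "h1 \<nabla> h2"]) simp_all
qed

lemma mono_if_on_projectives:
  assumes "\<And>y. projective A (D y) \<Longrightarrow> C y = D m \<Longrightarrow> m \<cdot> y = \<zero> (D y) (C m) \<Longrightarrow> y = \<zero> (D y) (D m)"
  shows "mono A m"
proof (rule monoI)
  fix y assume y: "C y = D m" "m \<cdot> y = \<zero> (D y) (C m)"
  obtain e where e: "projective A (D e)" "epi A e" "C e = D y" by (rule projective_cover)
  have "y \<cdot> e = \<zero> (D e) (D m)" using assms[of "y \<cdot> e"] cmp_eq[OF y(2), of e] e y by simp
  then show "y = \<zero> (D y) (D m)" by (intro epiD[OF e(2), of y]) (use e y in simp_all)
qed

lemma exact_if_on_projectives:
  assumes "C f = D g" "g \<cdot> f = \<zero> (D f) (C g)"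
    and lift: "\<And>y. projective A (D y) \<Longrightarrow> C y = D g \<Longrightarrow> g \<cdot> y = \<zero> (D y) (C g) \<Longrightarrow>
      \<exists>h. \<guillemotleft>h : D y \<rightarrow> D f\<guillemotright> \<and> f \<cdot> h = y"
  shows "is_exact A f g"
  unfolding is_exact_def
proof (intro conjI allI impI; (elim conjE)?)
  fix y z assume y: "C y = D g" "g \<cdot> y = \<zero> (D y) (C g)" and z: "D z = C f" "z \<cdot> f = \<zero> (D f) (C z)"
  obtain e where e: "projective A (D e)" "epi A e" "C e = D y" by (rule projective_cover)
  obtain h where h: "\<guillemotleft>h : D e \<rightarrow> D f\<guillemotright>" "f \<cdot> h = y \<cdot> e"
    using lift[of "y \<cdot> e"] cmp_eq[OF y(2), of e] e y by auto
  have "z \<cdot> y \<cdot> e = \<zero> (D e) (C z)" using cmp_eq[OF z(2), of h] h z by simp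
  then show "z \<cdot> y = \<zero> (D y) (C z)"
    by (intro epiD[OF e(2), of "z \<cdot> y"]) (use e y z assms(1) in simp_all)
qed (use assms in simp_all)

lemma exact_projective_lift:
  assumes exact: "is_exact A f g" and y: "projective A (D y)" "C y = D g" "g \<cdot> y = \<zero> (D y) (C g)"
  obtains h where "\<guillemotleft>h : D y \<rightarrow> D f\<guillemotright>" "f \<cdot> h = y"
proof -
  obtain c where c: "is_cokernel A f c" using ex_cokernel by blast
  obtain m where m: "is_kernel A c m" using ex_kernel by blast
  obtain e where e: "\<guillemotleft>e : D f \<rightarrow> D m\<guillemotright>" "m \<cdot> e = f" "epi A e" by (rule image_factorization[OF c m])
  have "c \<cdot> y = \<zero> (D y) (C c)"
    using cokernelD[OF c] by (intro exact_cmp_zero[OF exact y(2,3)]) simp_all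
  then obtain y' where y': "\<guillemotleft>y' : D y \<rightarrow> D m\<guillemotright>" "m \<cdot> y' = y"
    using kernel_factor[OF m, of y] y(2) exact_type[OF exact] cokernel_type[OF c] by metis
  obtain h where h: "\<guillemotleft>h : D y \<rightarrow> D e\<guillemotright>" "e \<cdot> h = y'"
    using projective_lift[OF e(3), of y'] y(1) y' e(1) by metis
  have "f \<cdot> h = m \<cdot> e \<cdot> h" using cmp_eq[OF e(2), of h] e(1) h(1) kernel_type[OF m] by simp
  also have "\<dots> = y" using h(2) y'(2) by simp
  finally have "f \<cdot> h = y" .
  then show thesis using that h(1) e(1) by simp
qed

lemma ex_projective_exact:
  obtains p where "projective A (D p)" "is_exact A p g"
proof -
  obtain n where n: "is_kernel A g n" using ex_kernel by blast
  note nD = kernelD[OF n]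
  obtain e where e: "projective A (D e)" "epi A e" "C e = D n" by (rule projective_cover)
  have "is_exact A (n \<cdot> e) g"
  proof (rule exact_if_on_projectives)
    show "g \<cdot> n \<cdot> e = \<zero> (D (n \<cdot> e)) (C g)" using cmp_eq[OF nD(2), of e] nD(1) e(3) by simp
    fix y assume y: "projective A (D y)" "C y = D g" "g \<cdot> y = \<zero> (D y) (C g)"
    obtain y' where y': "\<guillemotleft>y' : D y \<rightarrow> D n\<guillemotright>" "n \<cdot> y' = y" using kernel_factor[OF n y(2,3)] .
    obtain h where h: "\<guillemotleft>h : D y \<rightarrow> D e\<guillemotright>" "e \<cdot> h = y'"
      using projective_lift[OF e(2), of y'] y(1) y'(1) e(3) by metis
    then show "\<exists>h. \<guillemotleft>h : D y \<rightarrow> D (n \<cdot> e)\<guillemotright> \<and> (n \<cdot> e) \<cdot> h = y"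
      using y' e(3) by (intro exI[of _ h]) simp
  qed (use nD e(3) in simp_all)
  then show thesis using that[of "n \<cdot> e"] e(1,3) nD(1) by simp
qed

end

section \<open>Cells and the total complex\<close>

context preadditive_category
begin

lemma mor_iff:
  "c_mor A a b f \<longleftrightarrow> \<guillemotleft>fst f : C a \<rightarrow> C b\<guillemotright> \<and> \<guillemotleft>snd f : D a \<rightarrow> D b\<guillemotright> \<and> b \<cdot> snd f = fst f \<cdot> a"
  by (simp add: c_mor_def conj_assoc)

lemma cell_iff:
  "c_cell A a b f g \<alpha> \<longleftrightarrow> c_mor A a b f \<and> c_mor A a b g \<and> \<guillemotleft>\<alpha> : C a \<rightarrow> D b\<guillemotright>
    \<and> snd f = \<alpha> \<cdot> a \<oplus> snd g \<and> fst f = b \<cdot> \<alpha> \<oplus> fst g"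
proof (cases "c_mor A a b f \<and> c_mor A a b g \<and> \<guillemotleft>\<alpha> : C a \<rightarrow> D b\<guillemotright>")
  case True
  then show ?thesis by (simp add: c_cell_def mor_iff msub_eq_iff)
qed (auto simp: c_cell_def)

lemma mor_comp: "c_mor A a b f \<Longrightarrow> c_mor A b c g \<Longrightarrow> c_mor A a c (c_comp A g f)"
  using cmp_eq[of c "snd g" _ "snd f"] cmp_eq[of b "snd f"] by (simp add: mor_iff c_comp_def)

lemma mor_zero: "c_mor A a b (c_zero A a b)"
  by (simp add: mor_iff c_zero_def)

lemma mor_id: "c_mor A a a (c_id A a)"
  by (simp add: mor_iff c_id_def)

lemma cell_to_zero_iff:
  assumes "c_mor A a b f"
  shows "c_cell A a b f (c_zero A a b) \<alpha> \<longleftrightarrow> \<guillemotleft>\<alpha> : C a \<rightarrow> D b\<guillemotright> \<and> snd f = \<alpha> \<cdot> a \<and> fst f = b \<cdot> \<alpha>"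
proof (cases "\<guillemotleft>\<alpha> : C a \<rightarrow> D b\<guillemotright>")
  case True
  then show ?thesis using assms mor_zero[of a b] by (simp add: cell_iff c_zero_def)
qed (auto simp: cell_iff)

lemma zero_cell_iff:
  "c_cell A a b (c_zero A a b) (c_zero A a b) \<alpha> \<longleftrightarrow>
    \<guillemotleft>\<alpha> : C a \<rightarrow> D b\<guillemotright> \<and> \<alpha> \<cdot> a = \<zero> (D a) (D b) \<and> b \<cdot> \<alpha> = \<zero> (C a) (C b)"
  unfolding cell_to_zero_iff[OF mor_zero] by (auto simp: c_zero_def)

lemmas c_simps = mor_iff cell_iff c_comp_def c_zero_def c_id_def c_idcell_def c_add_def
  c_neg_def wl_def wr_def

lemma parallel_cells:
  assumes "c_cell A x y v v' \<gamma>" "c_cell A x y v v' \<gamma>'"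
  shows "D \<gamma> = D \<gamma>'" "C \<gamma> = C \<gamma>'" "y \<cdot> \<gamma> = y \<cdot> \<gamma>'" "\<gamma> \<cdot> x = \<gamma>' \<cdot> x"
proof -
  have "y \<cdot> \<gamma> \<oplus> fst v' = y \<cdot> \<gamma>' \<oplus> fst v'" "\<gamma> \<cdot> x \<oplus> snd v' = \<gamma>' \<cdot> x \<oplus> snd v'"
    using assms by (simp_all add: cell_iff)
  then show "D \<gamma> = D \<gamma>'" "C \<gamma> = C \<gamma>'" "y \<cdot> \<gamma> = y \<cdot> \<gamma>'" "\<gamma> \<cdot> x = \<gamma>' \<cdot> x"
    using assms by (simp_all add: cell_iff mor_iff)
qed

lemma pullback_cell:
  assumes pullback: "is_pullback A m n k l"
    and v: "c_mor A x k v" "c_mor A x k v'" and \<beta>: "\<guillemotleft>\<beta> : C x \<rightarrow> D n\<guillemotright>"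
    and fst_eq: "m \<cdot> fst v = n \<cdot> \<beta> \<oplus> m \<cdot> fst v'" and snd_eq: "l \<cdot> snd v = \<beta> \<cdot> x \<oplus> l \<cdot> snd v'"
  obtains \<gamma> where "c_cell A x k v v' \<gamma>" "l \<cdot> \<gamma> = \<beta>"
proof -
  note type = pullback_type[OF pullback] v[unfolded mor_iff] \<beta>
  obtain \<gamma> where \<gamma>: "\<guillemotleft>\<gamma> : C x \<rightarrow> D l\<guillemotright>" "k \<cdot> \<gamma> = fst v \<oplus> \<ominus> (fst v')" "l \<cdot> \<gamma> = \<beta>"
    using pullback_factor[OF pullback, of "fst v \<oplus> \<ominus> (fst v')" \<beta>] type fst_eq by auto
  have "snd v = \<gamma> \<cdot> x \<oplus> snd v'"
    by (rule pullback_unique[OF pullback])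
      (use type \<gamma>(1) snd_eq cmp_eq[OF \<gamma>(2), of x] cmp_eq[OF \<gamma>(3), of x] in simp_all)
  then have "c_cell A x k v v' \<gamma>" using v type \<gamma> by (simp add: cell_iff)
  then show thesis using that \<gamma>(3) by blast
qed

lemma pushout_cell:
  assumes "is_pushout A m n i j" "c_mor A j x v" "c_mor A j x v'" "\<guillemotleft>\<beta> : C m \<rightarrow> D x\<guillemotright>"
    and "snd v \<cdot> n = \<beta> \<cdot> m \<oplus> snd v' \<cdot> n" "fst v \<cdot> i = x \<cdot> \<beta> \<oplus> fst v' \<cdot> i"
  obtains \<gamma> where "c_cell A j x v v' \<gamma>" "\<gamma> \<cdot> i = \<beta>"
proof -
  interpret op: preadditive_category "opposite A" by (rule opposite_preadditive_category)
  have "is_pullback (opposite A) n m j i" using op.pullback_sym assms(1) by simp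
  from op.pullback_cell[OF this, of x "prod.swap v" "prod.swap v'" \<beta>] show thesis
    using that assms(2-6) by auto
qed

end

context additive_category
begin

lemma ex1_cell_from_zero:
  assumes "c_mor A (\<zero> Z Z) x f" "c_mor A (\<zero> Z Z) x g"
  shows "\<exists>!\<alpha>. c_cell A (\<zero> Z Z) x f g \<alpha>"
proof (rule ex1I[of _ "\<zero> Z (D x)"])
  have "fst f = fst g" by (rule from_Z_unique) (use assms in \<open>simp_all add: mor_iff\<close>)
  moreover have "snd f = snd g" by (rule from_Z_unique) (use assms in \<open>simp_all add: mor_iff\<close>)
  ultimately show "c_cell A (\<zero> Z Z) x f g (\<zero> Z (D x))" using assms by (simp add: c_simps)
  show "\<alpha> = \<zero> Z (D x)" if "c_cell A (\<zero> Z Z) x f g \<alpha>" for \<alpha>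
    by (rule from_Z_unique) (use that in \<open>simp_all add: cell_iff\<close>)
qed

lemma ex1_cell_to_zero:
  "c_mor A x (\<zero> Z Z) f \<Longrightarrow> c_mor A x (\<zero> Z Z) g \<Longrightarrow> \<exists>!\<alpha>. c_cell A x (\<zero> Z Z) f g \<alpha>"
  using additive_category.ex1_cell_from_zero[OF opposite_additive_category,
      of x "prod.swap f" "prod.swap g"]
  by (simp add: Z_opposite)

text \<open>For \<open>f : a \<rightarrow> b\<close> these are the two maps of the mapping cone \<open>A1 \<rightarrow> A0 \<oplus> B1 \<rightarrow> B0\<close>, and \<open>link\<close> is the
  middle map of the total complex of a null sequence.\<close>
definition cone_in :: "'m \<Rightarrow> 'm \<times> 'm \<Rightarrow> 'm" where
  "cone_in a f = a \<triangle> snd f"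

definition cone_out :: "'m \<Rightarrow> 'm \<times> 'm \<Rightarrow> 'm" where
  "cone_out b f = fst f \<nabla> \<ominus> b"

definition link :: "'m \<times> 'm \<Rightarrow> 'm \<Rightarrow> 'm \<Rightarrow> 'm \<times> 'm \<Rightarrow> 'm" where
  "link u \<kappa> a f = (fst u \<triangle> \<kappa>) \<nabla> \<ominus> cone_in a f"

lemma cone_type [simp]:
  assumes "c_mor A a b f"
  shows "D (cone_in a f) = D a" "C (cone_in a f) = C a \<boxplus> D b"
    "D (cone_out b f) = C a \<boxplus> D b" "C (cone_out b f) = C b"
  using assms by (simp_all add: mor_iff cone_in_def cone_out_def)

lemma pullback_iff_cone:
  "c_mor A a b f \<Longrightarrow> is_pullback A (fst f) b a (snd f) \<longleftrightarrow> is_kernel A (cone_out b f) (cone_in a f)"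
  by (simp add: pullback_iff_kernel mor_iff cone_in_def cone_out_def)

lemma pushout_iff_cone:
  "c_mor A a b f \<Longrightarrow> is_pushout A a (snd f) (fst f) b \<longleftrightarrow> is_cokernel A (cone_in a f) (cone_out b f)"
  by (simp add: pushout_iff_cokernel mor_iff cone_in_def cone_out_def)

lemma zero_cell_wl_iff:
  assumes "c_mor A a b f"
  shows "c_cell A x a (c_zero A x a) (c_zero A x a) \<rho> \<and> wl A f \<rho> = c_idcell A x b \<longleftrightarrow>
    \<guillemotleft>\<rho> : C x \<rightarrow> D a\<guillemotright> \<and> \<rho> \<cdot> x = \<zero> (D x) (D a) \<and> cone_in a f \<cdot> \<rho> = \<zero> (C x) (C a \<boxplus> D b)"
  using assms by (auto simp: zero_cell_iff mor_iff wl_def c_idcell_def cone_in_def)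

lemma zero_cell_wr_iff:
  assumes "c_mor A a b f"
  shows "c_cell A b x (c_zero A b x) (c_zero A b x) \<rho> \<and> wr A \<rho> f = c_idcell A a x \<longleftrightarrow>
    \<guillemotleft>\<rho> : C b \<rightarrow> D x\<guillemotright> \<and> x \<cdot> \<rho> = \<zero> (C b) (C x) \<and> \<rho> \<cdot> cone_out b f = \<zero> (C a \<boxplus> D b) (D x)"
  using assms by (auto simp: zero_cell_iff mor_iff wr_def c_idcell_def cone_out_def)

lemma cone_out_cone_in: "c_mor A a b f \<Longrightarrow> cone_out b f \<cdot> cone_in a f = \<zero> (D a) (C b)"
  by (simp add: mor_iff cone_in_def cone_out_def)

context
  fixes k a b u f \<kappa>
  assumes u: "c_mor A k a u" and f: "c_mor A a b f"
    and \<kappa>: "c_cell A k b (c_comp A f u) (c_zero A k b) \<kappa>"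
begin

lemma null_cell: "\<guillemotleft>\<kappa> : C k \<rightarrow> D b\<guillemotright>" "fst f \<cdot> fst u = b \<cdot> \<kappa>" "snd f \<cdot> snd u = \<kappa> \<cdot> k"
  using \<kappa> unfolding cell_to_zero_iff[OF mor_comp[OF u f]] by (auto simp: c_comp_def)

lemma link_type: "\<guillemotleft>link u \<kappa> a f : C k \<boxplus> D a \<rightarrow> C a \<boxplus> D b\<guillemotright>"
  using u f null_cell(1) by (simp add: link_def mor_iff cone_in_def)

lemma link_cone_in: "link u \<kappa> a f \<cdot> cone_in k u = \<zero> (D k) (C a \<boxplus> D b)"
  using u f null_cell by (simp add: mor_iff link_def cone_in_def)

lemma cone_out_link: "cone_out b f \<cdot> link u \<kappa> a f = \<zero> (C k \<boxplus> D a) (C b)"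
  using u f null_cell by (simp add: mor_iff link_def cone_in_def cone_out_def)

lemma link_eq_pair: "link u \<kappa> a f = (fst u \<nabla> \<ominus> a) \<triangle> (\<kappa> \<nabla> \<ominus> (snd f))"
  using u f null_cell(1) by (simp add: mor_iff link_def cone_in_def copair_pair_interchange)

end

end

section \<open>Faithful 1-cells\<close>

context abelian_with_projectives
begin

abbreviation deg0 :: "'o \<Rightarrow> 'm" where "deg0 X \<equiv> \<zero> Z X"
abbreviation deg1 :: "'o \<Rightarrow> 'm" where "deg1 X \<equiv> \<zero> X Z"

lemma c_obj_deg: "projective A P \<Longrightarrow> c_obj A (deg0 P)" "c_obj A (deg1 X)"
  using projective_Z by (simp_all add: c_obj_def)

lemma faithful_type:
  assumes "c_faithful A a b f"
  shows "c_obj A a" "c_obj A b" "c_mor A a b f"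
  using assms unfolding c_faithful_def by auto

lemma cofaithful_type:
  assumes "c_cofaithful A a b f"
  shows "c_obj A a" "c_obj A b" "c_mor A a b f"
  using assms unfolding c_cofaithful_def by auto

lemma fully_faithful_faithful: "c_fully_faithful A a b f \<Longrightarrow> c_faithful A a b f"
  unfolding c_fully_faithful_def by blast

lemma fully_cofaithful_cofaithful: "c_fully_cofaithful A a b f \<Longrightarrow> c_cofaithful A a b f"
  unfolding c_fully_cofaithful_def by blast

context
  fixes a b f
  assumes a: "c_obj A a" and b: "c_obj A b" and f: "c_mor A a b f"
begin

lemma faithful_iff_mono: "c_faithful A a b f \<longleftrightarrow> mono A (cone_in a f)"
proof
  assume faithful: "c_faithful A a b f"
  show "mono A (cone_in a f)"
  proof (rule mono_if_on_projectives)
    fix y assume P: "projective A (D y)" and y: "C y = D (cone_in a f)"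
      "cone_in a f \<cdot> y = \<zero> (D y) (C (cone_in a f))"
    let ?x = "deg0 (D y)"
    have "c_cell A ?x a (c_zero A ?x a) (c_zero A ?x a) y"
      "c_cell A ?x a (c_zero A ?x a) (c_zero A ?x a) (\<zero> (D y) (D a))"
      "wl A f y = wl A f (\<zero> (D y) (D a))"
      using y f by (simp_all add: c_simps cone_in_def)
    then show "y = \<zero> (D y) (D (cone_in a f))"
      using faithful c_obj_deg(1)[OF P] f unfolding c_faithful_def by (metis cone_type(1))
  qed
next
  assume mono: "mono A (cone_in a f)"
  have "\<alpha> = \<beta>" if c: "c_cell A x a g h \<alpha>" "c_cell A x a g h \<beta>" "wl A f \<alpha> = wl A f \<beta>" for x g h \<alpha> \<beta>
    by (rule monoD[OF mono])
      (use parallel_cells[OF c(1,2)] c f in \<open>simp_all add: c_simps cone_in_def\<close>)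
  then show "c_faithful A a b f" using a b f unfolding c_faithful_def by blast
qed

lemma cofaithful_iff_epi: "c_cofaithful A a b f \<longleftrightarrow> epi A (cone_out b f)"
proof
  assume cofaithful: "c_cofaithful A a b f"
  show "epi A (cone_out b f)"
  proof (rule epiI)
    fix y assume y: "D y = C (cone_out b f)" "y \<cdot> cone_out b f = \<zero> (D (cone_out b f)) (C y)"
    let ?x = "deg1 (C y)"
    have "c_cell A b ?x (c_zero A b ?x) (c_zero A b ?x) y"
      "c_cell A b ?x (c_zero A b ?x) (c_zero A b ?x) (\<zero> (C b) (C y))"
      "wr A y f = wr A (\<zero> (C b) (C y)) f"
      using y f by (simp_all add: c_simps cone_out_def)
    then show "y = \<zero> (C (cone_out b f)) (C y)"
      using cofaithful c_obj_deg(2) f unfolding c_cofaithful_def by (metis cone_type(4))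
  qed
next
  assume epi: "epi A (cone_out b f)"
  have "\<alpha> = \<beta>" if c: "c_cell A b x g h \<alpha>" "c_cell A b x g h \<beta>" "wr A \<alpha> f = wr A \<beta> f" for x g h \<alpha> \<beta>
    by (rule epiD[OF epi])
      (use parallel_cells[OF c(1,2)] c f in \<open>simp_all add: c_simps cone_out_def\<close>)
  then show "c_cofaithful A a b f" using a b f unfolding c_cofaithful_def by blast
qed

lemma fully_faithful_iff_pullback: "c_fully_faithful A a b f \<longleftrightarrow> is_pullback A (fst f) b a (snd f)"
proof
  assume fully_faithful: "c_fully_faithful A a b f"
  have "is_exact A (cone_in a f) (cone_out b f)"
  proof (rule exact_if_on_projectives)
    fix y assume P: "projective A (D y)" and y: "C y = D (cone_out b f)"
      "cone_out b f \<cdot> y = \<zero> (D y) (C (cone_out b f))"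
    obtain z w where zw: "D z = D w" "C z = C a" "C w = D b" "y = z \<triangle> w"
      using pair_cases[of y "C a" "D b"] y(1) f by auto
    let ?x = "deg0 (D y)" and ?g = "(z, \<zero> Z (D a))"
    have "c_mor A ?x a ?g" "c_cell A ?x b (c_comp A f ?g) (c_comp A f (c_zero A ?x a)) w"
      using y zw f by (simp_all add: c_simps cone_out_def)
    then obtain \<alpha> where "c_cell A ?x a ?g (c_zero A ?x a) \<alpha>" "wl A f \<alpha> = w"
      using fully_faithful c_obj_deg(1)[OF P] mor_zero unfolding c_fully_faithful_def by blast
    then show "\<exists>h. \<guillemotleft>h : D y \<rightarrow> D (cone_in a f)\<guillemotright> \<and> cone_in a f \<cdot> h = y"
      using zw f by (intro exI[of _ \<alpha>]) (simp add: c_simps cone_in_def)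
  qed (use f cone_out_cone_in in simp_all)
  then show "is_pullback A (fst f) b a (snd f)"
    using fully_faithful exact_mono_is_kernel
    unfolding c_fully_faithful_def faithful_iff_mono pullback_iff_cone[OF f]
    by blast
next
  assume pullback: "is_pullback A (fst f) b a (snd f)"
  have "c_faithful A a b f"
    using pullback kernel_mono unfolding faithful_iff_mono pullback_iff_cone[OF f] by blast
  moreover have "\<exists>\<alpha>. c_cell A x a g h \<alpha> \<and> wl A f \<alpha> = \<gamma>"
    if c: "c_mor A x a g" "c_mor A x a h" "c_cell A x b (c_comp A f g) (c_comp A f h) \<gamma>" for x g h \<gamma>
    using pullback_cell[OF pullback c(1,2), of \<gamma>] c(3) unfolding wl_def
    by (auto simp: cell_iff c_comp_def)
  ultimately show "c_fully_faithful A a b f" unfolding c_fully_faithful_def by blast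
qed

lemma fully_cofaithful_iff_pushout: "c_fully_cofaithful A a b f \<longleftrightarrow> is_pushout A a (snd f) (fst f) b"
proof
  assume fully_cofaithful: "c_fully_cofaithful A a b f"
  have "is_exact A (cone_in a f) (cone_out b f)"
  proof (rule exact_if_weak_cokernel)
    fix y assume y: "D y = C (cone_in a f)" "y \<cdot> cone_in a f = \<zero> (D (cone_in a f)) (C y)"
    obtain z w where zw: "D z = C a" "D w = D b" "C z = C w" "y = z \<nabla> w"
      using copair_cases[of y "C a" "D b"] y(1) f by auto
    let ?x = "deg1 (C y)" and ?g = "(\<zero> (C b) Z, \<ominus> w)"
    have "c_mor A b ?x ?g" "c_cell A a ?x (c_comp A ?g f) (c_comp A (c_zero A b ?x) f) z"
      using y zw f by (simp_all add: c_simps cone_in_def)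
    then obtain \<alpha> where "c_cell A b ?x ?g (c_zero A b ?x) \<alpha>" "wr A \<alpha> f = z"
      using fully_cofaithful c_obj_deg(2) mor_zero unfolding c_fully_cofaithful_def by blast
    then show "\<exists>h. \<guillemotleft>h : C (cone_out b f) \<rightarrow> C y\<guillemotright> \<and> h \<cdot> cone_out b f = y"
      using zw f by (intro exI[of _ \<alpha>]) (simp add: c_simps cone_out_def neg_eq_swap[of "\<alpha> \<cdot> b"])
  qed (use f cone_out_cone_in in simp_all)
  then show "is_pushout A a (snd f) (fst f) b"
    using fully_cofaithful exact_epi_is_cokernel
    unfolding c_fully_cofaithful_def cofaithful_iff_epi pushout_iff_cone[OF f]
    by blast
next
  assume pushout: "is_pushout A a (snd f) (fst f) b"
  have "c_cofaithful A a b f"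
    using pushout cokernel_epi unfolding cofaithful_iff_epi pushout_iff_cone[OF f] by blast
  moreover have "\<exists>\<alpha>. c_cell A b x g h \<alpha> \<and> wr A \<alpha> f = \<gamma>"
    if c: "c_mor A b x g" "c_mor A b x h" "c_cell A a x (c_comp A g f) (c_comp A h f) \<gamma>" for x g h \<gamma>
    using pushout_cell[OF pushout c(1,2), of \<gamma>] c(3) unfolding wr_def
    by (auto simp: cell_iff c_comp_def)
  ultimately show "c_fully_cofaithful A a b f" unfolding c_fully_cofaithful_def by blast
qed

end

section \<open>2-kernels and 2-cokernels\<close>

lemma pullback_homotopy_lift:
  assumes pullback: "is_pullback A m n k l" and exact: "is_exact A (m \<nabla> \<ominus> n) g"
    and x: "projective A (C x)" and t: "\<guillemotleft>t : C x \<rightarrow> C m\<guillemotright>" "g \<cdot> t = \<zero> (C x) (C g)"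
    and w: "\<guillemotleft>w : D x \<rightarrow> D n\<guillemotright>" "t \<cdot> x = n \<cdot> w"
  obtains v \<beta> where "c_mor A x k v" "\<guillemotleft>\<beta> : C x \<rightarrow> D n\<guillemotright>"
    "m \<cdot> fst v = n \<cdot> \<beta> \<oplus> t" "l \<cdot> snd v = \<beta> \<cdot> x \<oplus> w"
proof -
  note type = pullback_type[OF pullback]
  obtain y where y: "\<guillemotleft>y : C x \<rightarrow> D m \<boxplus> D n\<guillemotright>" "(m \<nabla> \<ominus> n) \<cdot> y = t"
    using exact_projective_lift[OF exact, of t] x t type exact_type[OF exact] by auto
  obtain v0 \<beta> where v0: "D v0 = D \<beta>" "C v0 = D m" "C \<beta> = D n" "y = v0 \<triangle> \<beta>"
    using y(1) by (auto elim: pair_cases)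
  have \<beta>: "D \<beta> = C x" using y(1) v0 by simp
  have m_v0: "m \<cdot> v0 = n \<cdot> \<beta> \<oplus> t" using y(2) v0 \<beta> type t(1) by (auto simp: add_ac)
  have "m \<cdot> v0 \<cdot> x = n \<cdot> (\<beta> \<cdot> x \<oplus> w)" using cmp_eq[OF m_v0, of x] v0 \<beta> type t(1) w by simp
  then obtain v1 where "\<guillemotleft>v1 : D x \<rightarrow> D l\<guillemotright>" "k \<cdot> v1 = v0 \<cdot> x" "l \<cdot> v1 = \<beta> \<cdot> x \<oplus> w"
    using pullback_factor[OF pullback, of "v0 \<cdot> x" "\<beta> \<cdot> x \<oplus> w"] v0 \<beta> w(1) by auto
  then show thesis using that[of "(v0, v1)" \<beta>] v0 \<beta> m_v0 type by (simp add: mor_iff)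
qed

lemma pushout_homotopy_extend:
  assumes pushout: "is_pushout A m n i j" and exact: "is_exact A e (m \<triangle> n)"
    and j: "projective A (C j)" and h: "\<guillemotleft>h : D n \<rightarrow> D x\<guillemotright>" "h \<cdot> e = \<zero> (D e) (D x)"
    and w: "\<guillemotleft>w : C m \<rightarrow> C x\<guillemotright>" "w \<cdot> m = x \<cdot> h"
  obtains v \<beta> where "c_mor A j x v" "\<guillemotleft>\<beta> : C m \<rightarrow> D x\<guillemotright>"
    "fst v \<cdot> i = x \<cdot> \<beta> \<oplus> w" "snd v \<cdot> n = \<beta> \<cdot> m \<oplus> h"
proof -
  note type = pushout_type[OF pushout]
  have cokernel: "is_cokernel A (m \<triangle> n) (i \<nabla> \<ominus> j)"
    using pushout type by (simp add: pushout_iff_cokernel)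
  obtain h' where h': "\<guillemotleft>h' : C m \<boxplus> C n \<rightarrow> D x\<guillemotright>" "h' \<cdot> (m \<triangle> n) = h"
    using extend_along_exact[OF exact cokernel_exact[OF cokernel] cokernel_epi[OF cokernel], of h]
      j h type
    by auto
  obtain z v1 where zv: "D z = C m" "D v1 = C n" "C z = C v1" "h' = z \<nabla> v1"
    using h'(1) by (auto elim: copair_cases)
  define \<beta> where "\<beta> = \<ominus> z"
  have \<beta>: "\<guillemotleft>\<beta> : C m \<rightarrow> D x\<guillemotright>" "C v1 = D x" using h'(1) zv by (auto simp: \<beta>_def)
  have v1_n: "v1 \<cdot> n = \<beta> \<cdot> m \<oplus> h" using h'(2) zv \<beta>(2) type by (auto simp: \<beta>_def)
  have "(x \<cdot> \<beta> \<oplus> w) \<cdot> m = (x \<cdot> v1) \<cdot> n" using v1_n \<beta> zv(2) w h(1) type by simp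
  then obtain v0 where "\<guillemotleft>v0 : C j \<rightarrow> C x\<guillemotright>" "v0 \<cdot> i = x \<cdot> \<beta> \<oplus> w" "v0 \<cdot> j = x \<cdot> v1"
    using pushout_factor[OF pushout, of "x \<cdot> \<beta> \<oplus> w" "x \<cdot> v1"] \<beta> zv(2) w(1) type by auto
  then show thesis using that[of "(v0, v1)" \<beta>] \<beta> zv(2) v1_n type by (simp add: mor_iff)
qed

lemma two_kernel_type:
  assumes "c_is_2kernel A a b f k u \<kappa>"
  shows "c_mor A k a u" "c_cell A k b (c_comp A f u) (c_zero A k b) \<kappa>"
  using assms unfolding c_is_2kernel_def by auto

lemma two_cokernel_type:
  assumes "c_is_2cokernel A k a u b f \<kappa>"
  shows "c_mor A a b f" "c_cell A k b (c_comp A f u) (c_zero A k b) \<kappa>"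
  using assms unfolding c_is_2cokernel_def by auto

context
  fixes k a b u f \<kappa>
  assumes u: "c_mor A k a u" and f: "c_mor A a b f"
    and \<kappa>: "c_cell A k b (c_comp A f u) (c_zero A k b) \<kappa>"
begin

lemma null_pair_lift:
  assumes pullback: "is_pullback A (fst u \<triangle> \<kappa>) (cone_in a f) k (snd u)"
    and exact: "is_exact A (link u \<kappa> a f) (cone_out b f)"
    and x: "c_obj A x" and w: "c_mor A x a w" and \<phi>: "c_cell A x b (c_comp A f w) (c_zero A x b) \<phi>"
  obtains v \<beta> where "c_mor A x k v" "c_cell A x a (c_comp A u v) w \<beta>" "wr A \<kappa> v = wl A f \<beta> \<oplus> \<phi>"
proof -
  note type = u[unfolded mor_iff] f[unfolded mor_iff] w[unfolded mor_iff]
    and null = null_cell[OF u f \<kappa>] null_cell[OF w f \<phi>]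
  obtain v \<beta> where v: "c_mor A x k v" and "\<guillemotleft>\<beta> : C x \<rightarrow> D (cone_in a f)\<guillemotright>"
    and "(fst u \<triangle> \<kappa>) \<cdot> fst v = cone_in a f \<cdot> \<beta> \<oplus> (fst w \<triangle> \<phi>)" "snd u \<cdot> snd v = \<beta> \<cdot> x \<oplus> snd w"
    by (rule pullback_homotopy_lift[OF pullback exact[unfolded link_def], of x "fst w \<triangle> \<phi>" "snd w"])
      (use x type null in \<open>simp_all add: c_obj_def cone_in_def cone_out_def\<close>)
  then have "c_cell A x a (c_comp A u v) w \<beta>" "wr A \<kappa> v = wl A f \<beta> \<oplus> \<phi>"
    using mor_comp[OF v u] w v[unfolded mor_iff] type null
    by (simp_all add: cell_iff c_comp_def wl_def wr_def cone_in_def)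
  with v that show thesis by blast
qed

lemma two_kernelI:
  assumes k: "c_obj A k" and pullback: "is_pullback A (fst u \<triangle> \<kappa>) (cone_in a f) k (snd u)"
    and exact: "is_exact A (link u \<kappa> a f) (cone_out b f)"
  shows "c_is_2kernel A a b f k u \<kappa>"
proof -
  note type = u[unfolded mor_iff] f[unfolded mor_iff] null_cell[OF u f \<kappa>]
  have "\<exists>v \<beta>. c_mor A x k v \<and> c_cell A x a (c_comp A u v) w \<beta> \<and> wr A \<kappa> v = wl A f \<beta> \<oplus> \<phi>"
    if "c_obj A x" "c_mor A x a w" "c_cell A x b (c_comp A f w) (c_zero A x b) \<phi>" for x w \<phi>
    using null_pair_lift[OF pullback exact that] by blast
  moreover have "\<exists>\<gamma>. c_cell A x k v v' \<gamma> \<and> wl A u \<gamma> = \<beta>"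
    if v: "c_mor A x k v" "c_mor A x k v'" and \<beta>: "c_cell A x a (c_comp A u v) (c_comp A u v') \<beta>"
      "wr A \<kappa> v = wl A f \<beta> \<oplus> wr A \<kappa> v'" for x v v' \<beta>
    by (rule pullback_cell[OF pullback v, of \<beta>])
      (use v[unfolded mor_iff] \<beta> type in \<open>auto simp: cell_iff c_comp_def wl_def wr_def cone_in_def\<close>)
  moreover have "\<gamma> = \<gamma>'"
    if \<gamma>: "c_cell A x k v v' \<gamma>" "c_cell A x k v v' \<gamma>'" "wl A u \<gamma> = wl A u \<gamma>'" for x v v' \<gamma> \<gamma>'
    by (rule pullback_unique[OF pullback])
      (use parallel_cells[OF \<gamma>(1,2)] \<gamma> type in \<open>simp_all add: cell_iff wl_def\<close>)
  ultimately show ?thesis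
    unfolding c_is_2kernel_def using k u \<kappa> by blast
qed

lemma null_pair_extend:
  assumes b: "c_obj A b" and exact: "is_exact A (cone_in k u) (link u \<kappa> a f)"
    and pushout: "is_pushout A (fst u \<nabla> \<ominus> a) (\<kappa> \<nabla> \<ominus> (snd f)) (fst f) b"
    and w: "c_mor A a x w" and \<phi>: "c_cell A k x (c_comp A w u) (c_zero A k x) \<phi>"
  obtains v \<beta> where "c_mor A b x v" "c_cell A a x (c_comp A v f) w \<beta>" "wl A v \<kappa> = wr A \<beta> u \<oplus> \<phi>"
proof -
  note type = u[unfolded mor_iff] f[unfolded mor_iff] w[unfolded mor_iff]
    and null = null_cell[OF u f \<kappa>] null_cell[OF u w \<phi>]
  obtain v \<beta> where v: "c_mor A b x v" and "\<guillemotleft>\<beta> : C (fst u \<nabla> \<ominus> a) \<rightarrow> D x\<guillemotright>"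
    and "fst v \<cdot> fst f = x \<cdot> \<beta> \<oplus> fst w"
      "snd v \<cdot> (\<kappa> \<nabla> \<ominus> (snd f)) = \<beta> \<cdot> (fst u \<nabla> \<ominus> a) \<oplus> (\<phi> \<nabla> \<ominus> (snd w))"
    by (rule pushout_homotopy_extend[OF pushout exact[unfolded link_eq_pair[OF u f \<kappa>]],
          of "\<phi> \<nabla> \<ominus> (snd w)" x "fst w"])
      (use b type null in \<open>simp_all add: c_obj_def cone_in_def\<close>)
  then have "c_cell A a x (c_comp A v f) w \<beta>" "wl A v \<kappa> = wr A \<beta> u \<oplus> \<phi>"
    using mor_comp[OF f v] w v[unfolded mor_iff] type null
    by (simp_all add: cell_iff c_comp_def wl_def wr_def flip: neg_add)
  with v that show thesis by blast
qed

lemma two_cokernelI: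
  assumes b: "c_obj A b" and exact: "is_exact A (cone_in k u) (link u \<kappa> a f)"
    and pushout: "is_pushout A (fst u \<nabla> \<ominus> a) (\<kappa> \<nabla> \<ominus> (snd f)) (fst f) b"
  shows "c_is_2cokernel A k a u b f \<kappa>"
proof -
  note type = u[unfolded mor_iff] f[unfolded mor_iff] null_cell[OF u f \<kappa>]
  have "\<exists>v \<beta>. c_mor A b x v \<and> c_cell A a x (c_comp A v f) w \<beta> \<and> wl A v \<kappa> = wr A \<beta> u \<oplus> \<phi>"
    if "c_mor A a x w" "c_cell A k x (c_comp A w u) (c_zero A k x) \<phi>" for x w \<phi>
    using null_pair_extend[OF b exact pushout that] by blast
  moreover have "\<exists>\<gamma>. c_cell A b x v v' \<gamma> \<and> wr A \<gamma> f = \<beta>"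
    if v: "c_mor A b x v" "c_mor A b x v'" and \<beta>: "c_cell A a x (c_comp A v f) (c_comp A v' f) \<beta>"
      "wl A v \<kappa> = wr A \<beta> u \<oplus> wl A v' \<kappa>" for x v v' \<beta>
    by (rule pushout_cell[OF pushout v, of \<beta>])
      (use v[unfolded mor_iff] \<beta> type in \<open>auto simp: cell_iff c_comp_def wl_def wr_def\<close>)
  moreover have "\<gamma> = \<gamma>'"
    if \<gamma>: "c_cell A b x v v' \<gamma>" "c_cell A b x v v' \<gamma>'" "wr A \<gamma> f = wr A \<gamma>' f" for x v v' \<gamma> \<gamma>'
    by (rule pushout_unique[OF pushout])
      (use parallel_cells[OF \<gamma>(1,2)] \<gamma> type in \<open>simp_all add: cell_iff wr_def\<close>)
  ultimately show ?thesis
    unfolding c_is_2cokernel_def using b f \<kappa> by blast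
qed

lemma two_kernel_exact_in:
  assumes kernel: "c_is_2kernel A a b f k u \<kappa>"
  shows "is_exact A (cone_in k u) (link u \<kappa> a f)"
proof (rule exact_if_on_projectives)
  note type = u[unfolded mor_iff] f[unfolded mor_iff] null_cell[OF u f \<kappa>]
    and link = link_type[OF u f \<kappa>]
  fix y assume P: "projective A (D y)" and y: "C y = D (link u \<kappa> a f)"
    "link u \<kappa> a f \<cdot> y = \<zero> (D y) (C (link u \<kappa> a f))"
  obtain p r where pr: "D p = D r" "C p = C k" "C r = D a" "y = p \<triangle> r"
    using pair_cases[of y "C k" "D a"] y(1) link by auto
  let ?x = "deg0 (D y)" and ?v = "(p, \<zero> Z (D k))"
  let ?v' = "c_zero A ?x k"
  have "c_mor A ?x k ?v" "c_cell A ?x a (c_comp A u ?v) (c_comp A u ?v') r"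
    "wr A \<kappa> ?v = wl A f r \<oplus> wr A \<kappa> ?v'"
    using y(2) pr type by (simp_all add: c_simps link_def cone_in_def)
  then obtain \<gamma> where "c_cell A ?x k ?v ?v' \<gamma>" "wl A u \<gamma> = r"
    using kernel c_obj_deg(1)[OF P] mor_zero unfolding c_is_2kernel_def by blast
  then show "\<exists>h. \<guillemotleft>h : D y \<rightarrow> D (cone_in k u)\<guillemotright> \<and> cone_in k u \<cdot> h = y"
    using pr type by (intro exI[of _ \<gamma>]) (simp add: c_simps cone_in_def)
qed (use u link_type[OF u f \<kappa>] link_cone_in[OF u f \<kappa>] in simp_all)

lemma two_kernel_exact_out:
  assumes kernel: "c_is_2kernel A a b f k u \<kappa>"
  shows "is_exact A (link u \<kappa> a f) (cone_out b f)"
proof (rule exact_if_on_projectives)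
  note type = u[unfolded mor_iff] f[unfolded mor_iff] null_cell[OF u f \<kappa>]
    and link = link_type[OF u f \<kappa>]
  fix y assume P: "projective A (D y)" and y: "C y = D (cone_out b f)"
    "cone_out b f \<cdot> y = \<zero> (D y) (C (cone_out b f))"
  obtain z \<phi> where z\<phi>: "D z = D \<phi>" "C z = C a" "C \<phi> = D b" "y = z \<triangle> \<phi>"
    using pair_cases[of y "C a" "D b"] y(1) f by auto
  let ?x = "deg0 (D y)" and ?w = "(z, \<zero> Z (D a))"
  have "c_mor A ?x a ?w" "c_cell A ?x b (c_comp A f ?w) (c_zero A ?x b) \<phi>"
    using y(2) z\<phi> type by (simp_all add: c_simps cone_out_def)
  then obtain v \<beta> where "c_mor A ?x k v" "c_cell A ?x a (c_comp A u v) ?w \<beta>" "wr A \<kappa> v = wl A f \<beta> \<oplus> \<phi>"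
    using kernel c_obj_deg(1)[OF P] unfolding c_is_2kernel_def by blast
  then show "\<exists>h. \<guillemotleft>h : D y \<rightarrow> D (link u \<kappa> a f)\<guillemotright> \<and> link u \<kappa> a f \<cdot> h = y"
    using z\<phi> type link
    by (intro exI[of _ "fst v \<triangle> \<beta>"]) (simp add: c_simps link_def cone_in_def add_ac)
qed (use f link_type[OF u f \<kappa>] cone_out_link[OF u f \<kappa>] in simp_all)

lemma two_cokernel_exact_in:
  assumes cokernel: "c_is_2cokernel A k a u b f \<kappa>"
  shows "is_exact A (cone_in k u) (link u \<kappa> a f)"
proof (rule exact_if_weak_cokernel)
  note type = u[unfolded mor_iff] f[unfolded mor_iff] null_cell[OF u f \<kappa>]
    and link = link_type[OF u f \<kappa>]
  fix y assume y: "D y = C (cone_in k u)" "y \<cdot> cone_in k u = \<zero> (D (cone_in k u)) (C y)"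
  obtain \<phi> z where \<phi>z: "D \<phi> = C k" "D z = D a" "C \<phi> = C z" "y = \<phi> \<nabla> z"
    using copair_cases[of y "C k" "D a"] y(1) u by auto
  let ?x = "deg1 (C y)" and ?w = "(\<zero> (C a) Z, \<ominus> z)"
  have "c_mor A a ?x ?w" "c_cell A k ?x (c_comp A ?w u) (c_zero A k ?x) \<phi>"
    using y(2) \<phi>z type by (simp_all add: c_simps cone_in_def)
  then obtain v \<beta> where "c_mor A b ?x v" "c_cell A a ?x (c_comp A v f) ?w \<beta>" "wl A v \<kappa> = wr A \<beta> u \<oplus> \<phi>"
    using cokernel c_obj_deg(2) unfolding c_is_2cokernel_def by blast
  then show "\<exists>h. \<guillemotleft>h : C (link u \<kappa> a f) \<rightarrow> C y\<guillemotright> \<and> h \<cdot> link u \<kappa> a f = y"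
    using \<phi>z type link
    by (intro exI[of _ "\<ominus> \<beta> \<nabla> snd v"]) (simp add: c_simps link_def cone_in_def)
qed (use u link_type[OF u f \<kappa>] link_cone_in[OF u f \<kappa>] in simp_all)

lemma two_cokernel_exact_out:
  assumes cokernel: "c_is_2cokernel A k a u b f \<kappa>"
  shows "is_exact A (link u \<kappa> a f) (cone_out b f)"
proof (rule exact_if_weak_cokernel)
  note type = u[unfolded mor_iff] f[unfolded mor_iff] null_cell[OF u f \<kappa>]
    and link = link_type[OF u f \<kappa>]
  fix y assume y: "D y = C (link u \<kappa> a f)" "y \<cdot> link u \<kappa> a f = \<zero> (D (link u \<kappa> a f)) (C y)"
  obtain \<beta> z where \<beta>z: "D \<beta> = C a" "D z = D b" "C \<beta> = C z" "y = \<beta> \<nabla> z"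
    using copair_cases[of y "C a" "D b"] y(1) link by auto
  let ?x = "deg1 (C y)" and ?v = "(\<zero> (C b) Z, \<ominus> z)"
  let ?v' = "c_zero A b ?x"
  have "c_mor A b ?x ?v" "c_cell A a ?x (c_comp A ?v f) (c_comp A ?v' f) \<beta>"
    "wl A ?v \<kappa> = wr A \<beta> u \<oplus> wl A ?v' \<kappa>"
    using y(2) \<beta>z type by (simp_all add: c_simps link_def cone_in_def neg_eq_swap)
  then obtain \<gamma> where "c_cell A b ?x ?v ?v' \<gamma>" "wr A \<gamma> f = \<beta>"
    using cokernel c_obj_deg(2) mor_zero unfolding c_is_2cokernel_def by blast
  then show "\<exists>h. \<guillemotleft>h : C (cone_out b f) \<rightarrow> C y\<guillemotright> \<and> h \<cdot> cone_out b f = y"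
    using \<beta>z type by (intro exI[of _ \<gamma>]) (simp add: c_simps cone_out_def neg_eq_swap[of "\<gamma> \<cdot> b"])
qed (use f link_type[OF u f \<kappa>] cone_out_link[OF u f \<kappa>] in simp_all)

end

lemma ex_2kernel:
  assumes f: "c_mor A a b f"
  shows "\<exists>k u \<kappa>. c_is_2kernel A a b f k u \<kappa>"
proof -
  obtain p where p: "projective A (D p)" "is_exact A p (cone_out b f)" by (rule ex_projective_exact)
  obtain u0 \<kappa> where p_pair: "D u0 = D \<kappa>" "C u0 = C a" "C \<kappa> = D b" "p = u0 \<triangle> \<kappa>"
    using pair_cases[of p "C a" "D b"] exact_type[OF p(2)] f by auto
  obtain k u1 where pullback: "is_pullback A p (cone_in a f) k u1"
    using ex_pullback[of p "cone_in a f"] p_pair f by auto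
  note type = f[unfolded mor_iff] pullback_type[OF pullback]
  have k: "c_obj A k" using p(1) type by (simp add: c_obj_def)
  have u: "c_mor A k a (u0, u1)" and \<kappa>: "c_cell A k b (c_comp A f (u0, u1)) (c_zero A k b) \<kappa>"
    using pullback_commutes[OF pullback] exact_zero[OF p(2)] p_pair type cmp_eq[of b "snd f" _ u1]
      cmp_eq[of "fst f" u0 _ k]
    by (simp_all add: c_simps cone_in_def cone_out_def)
  have "is_exact A (link (u0, u1) \<kappa> a f) (cone_out b f)"
    unfolding link_def using p(2) p_pair f cone_out_cone_in[OF f] by (auto intro: exact_copair)
  then have "c_is_2kernel A a b f k (u0, u1) \<kappa>"
    using pullback p_pair by (intro two_kernelI[OF u f \<kappa> k]) simp_all
  then show ?thesis by blast
qed

lemma ex_2cokernel: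
  assumes b: "c_obj A b" and f: "c_mor A a b f"
  shows "\<exists>c q \<zeta>. c_is_2cokernel A a b f c q \<zeta>"
proof -
  obtain \<zeta> q where pushout: "is_pushout A a (snd f) \<zeta> q"
    using ex_pushout[of a "snd f"] f by (auto simp: mor_iff)
  note type = f[unfolded mor_iff] pushout_type(2-4)[OF pushout]
  obtain c where c: "\<guillemotleft>c : C q \<rightarrow> C b\<guillemotright>" "c \<cdot> \<zeta> = fst f" "c \<cdot> q = b"
    using pushout_factor[OF pushout, of "fst f" b] type by auto
  let ?q = "(I (C b), q)"
  have c_obj_c: "c_obj A c" using b c by (simp add: c_obj_def)
  have q: "c_mor A b c ?q" using c type by (simp add: mor_iff)
  have \<zeta>: "c_cell A a c (c_comp A ?q f) (c_zero A a c) \<zeta>"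
    unfolding cell_to_zero_iff[OF mor_comp[OF f q]] using c type pushout_commutes[OF pushout]
    by (simp add: c_comp_def)
  have "is_cokernel A (cone_in a f) (\<zeta> \<nabla> \<ominus> q)"
    using pushout type by (simp add: pushout_iff_cokernel cone_in_def)
  then have "is_exact A (cone_in a f) (link f \<zeta> b ?q)"
    unfolding link_eq_pair[OF f q \<zeta>] using type
    by (intro exact_pair cokernel_exact) (simp_all add: cone_in_def)
  moreover have "is_pushout A (fst f \<nabla> \<ominus> b) (\<zeta> \<nabla> \<ominus> q) (I (C b)) c"
  proof (rule pushoutI)
    fix x y assume xy: "C x = C y" "D x = C (fst f \<nabla> \<ominus> b)" "D y = C (\<zeta> \<nabla> \<ominus> q)"
      "x \<cdot> (fst f \<nabla> \<ominus> b) = y \<cdot> (\<zeta> \<nabla> \<ominus> q)"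
    have "x \<cdot> c = y" by (rule pushout_unique[OF pushout]) (use xy c type in simp_all)
    then show "\<exists>h. \<guillemotleft>h : C c \<rightarrow> C y\<guillemotright> \<and> h \<cdot> I (C b) = x \<and> h \<cdot> c = y"
      using xy c type by (intro exI[of _ x]) simp
  qed (use c type in simp_all)
  ultimately have "c_is_2cokernel A a b f c ?q \<zeta>"
    by (intro two_cokernelI[OF f q \<zeta> c_obj_c]) simp_all
  then show ?thesis by blast
qed

lemma faithful_is_2kernel:
  assumes faithful: "c_faithful A a b f" and cokernel: "c_is_2cokernel A a b f c q \<zeta>"
  shows "c_is_2kernel A b c q a f \<zeta>"
proof -
  note a = faithful_type(1)[OF faithful] and f = faithful_type(3)[OF faithful]
  note null = f two_cokernel_type[OF cokernel]
  have "is_kernel A (link f \<zeta> b q) (cone_in a f)"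
    using exact_mono_is_kernel[OF two_cokernel_exact_in[OF null cokernel]]
      faithful faithful_iff_mono[OF faithful_type[OF faithful]] by blast
  then have "is_pullback A (fst f \<triangle> \<zeta>) (cone_in b q) a (snd f)"
    using null(1,2) null_cell(1)[OF null]
    by (subst pullback_iff_kernel) (simp_all add: mor_iff link_def cone_in_def)
  then show ?thesis using two_kernelI[OF null a] two_cokernel_exact_out[OF null cokernel] by blast
qed

lemma cofaithful_is_2cokernel:
  assumes cofaithful: "c_cofaithful A a b f" and kernel: "c_is_2kernel A a b f k u \<kappa>"
  shows "c_is_2cokernel A k a u b f \<kappa>"
proof -
  note b = cofaithful_type(2)[OF cofaithful] and f = cofaithful_type(3)[OF cofaithful]
  note null = two_kernel_type(1)[OF kernel] f two_kernel_type(2)[OF kernel]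
  have "is_cokernel A (link u \<kappa> a f) (cone_out b f)"
    using exact_epi_is_cokernel[OF two_kernel_exact_out[OF null kernel]]
      cofaithful cofaithful_iff_epi[OF cofaithful_type[OF cofaithful]] by blast
  then have "is_pushout A (fst u \<nabla> \<ominus> a) (\<kappa> \<nabla> \<ominus> (snd f)) (fst f) b"
    using null(1,2) null_cell(1)[OF null] unfolding link_eq_pair[OF null]
    by (subst pushout_iff_cokernel) (simp_all add: mor_iff cone_out_def)
  then show ?thesis using two_cokernelI[OF null b] two_kernel_exact_in[OF null kernel] by blast
qed

section \<open>Pips, copips, roots and coroots\<close>

lemma pipI:
  assumes f: "c_mor A a b f" and \<pi>: "projective A (D \<pi>)" "is_exact A \<pi> (cone_in a f)"
    and p: "is_kernel A \<pi> p"
  shows "c_is_pip A a b f p \<pi>"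
proof -
  note pD = kernelD[OF p]
  have lift: "\<exists>v. c_mor A x p v \<and> wr A \<pi> v = \<rho>"
    if x: "c_obj A x"
      and \<rho>: "c_cell A x a (c_zero A x a) (c_zero A x a) \<rho> \<and> wl A f \<rho> = c_idcell A x b" for x \<rho>
  proof -
    note \<rho> = \<rho>[unfolded zero_cell_wl_iff[OF f]]
    obtain v0 where v0: "\<guillemotleft>v0 : C x \<rightarrow> D \<pi>\<guillemotright>" "\<pi> \<cdot> v0 = \<rho>"
      using exact_projective_lift[OF \<pi>(2), of \<rho>] \<rho> x f by (auto simp: c_obj_def)
    obtain v1 where "\<guillemotleft>v1 : D x \<rightarrow> D p\<guillemotright>" "p \<cdot> v1 = v0 \<cdot> x"
      using kernel_factor[OF p, of "v0 \<cdot> x"] cmp_eq[OF v0(2), of x] v0(1) \<rho> exact_type[OF \<pi>(2)] f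
      by auto
    then show ?thesis using v0 pD(1) by (intro exI[of _ "(v0, v1)"]) (simp add: mor_iff wr_def)
  qed
  have cell: "\<exists>\<gamma>. c_cell A x p v v' \<gamma>"
    if v: "c_mor A x p v" "c_mor A x p v'" and eq: "wr A \<pi> v = wr A \<pi> v'" for x v v'
  proof -
    note v_type = v[unfolded mor_iff]
    obtain \<gamma> where \<gamma>: "\<guillemotleft>\<gamma> : C x \<rightarrow> D p\<guillemotright>" "p \<cdot> \<gamma> = fst v \<oplus> \<ominus> (fst v')"
      using kernel_factor[OF p, of "fst v \<oplus> \<ominus> (fst v')"] eq v_type pD(1) by (auto simp: wr_def)
    have "snd v = \<gamma> \<cdot> x \<oplus> snd v'"
      by (rule monoD[OF kernel_mono[OF p]]) (use \<gamma>(1) cmp_eq[OF \<gamma>(2), of x] v_type in simp_all)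
    then show ?thesis using v v_type \<gamma> by (intro exI[of _ \<gamma>]) (simp add: cell_iff)
  qed
  have unique: "\<gamma> = \<gamma>'" if \<gamma>: "c_cell A x p v v' \<gamma>" "c_cell A x p v v' \<gamma>'" for x v v' \<gamma> \<gamma>'
    by (rule monoD[OF kernel_mono[OF p]]) (use parallel_cells[OF \<gamma>] \<gamma> in \<open>simp_all add: cell_iff\<close>)
  have p_obj: "c_obj A p" using \<pi>(1) pD(1) by (simp add: c_obj_def)
  have "c_cell A p a (c_zero A p a) (c_zero A p a) \<pi> \<and> wl A f \<pi> = c_idcell A p b"
    unfolding zero_cell_wl_iff[OF f] using exactD(1,2)[OF \<pi>(2)] pD f by simp
  with p_obj show ?thesis
    unfolding c_is_pip_def using lift cell unique by blast
qed

lemma ex_pip: "c_mor A a b f \<Longrightarrow> \<exists>p \<pi>. c_is_pip A a b f p \<pi>"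
  using ex_projective_exact[of "cone_in a f"] ex_kernel pipI by metis

lemma pip_exact:
  assumes f: "c_mor A a b f" and pip: "c_is_pip A a b f p \<pi>"
  shows "is_exact A \<pi> (cone_in a f)"
proof (rule exact_if_on_projectives)
  have "c_cell A p a (c_zero A p a) (c_zero A p a) \<pi> \<and> wl A f \<pi> = c_idcell A p b"
    using pip unfolding c_is_pip_def by blast
  then have \<pi>: "\<guillemotleft>\<pi> : C p \<rightarrow> D a\<guillemotright>" "cone_in a f \<cdot> \<pi> = \<zero> (C p) (C a \<boxplus> D b)"
    unfolding zero_cell_wl_iff[OF f] by auto
  then show "C \<pi> = D (cone_in a f)" "cone_in a f \<cdot> \<pi> = \<zero> (D \<pi>) (C (cone_in a f))"
    using f by simp_all
  fix y assume P: "projective A (D y)"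
    and y: "C y = D (cone_in a f)" "cone_in a f \<cdot> y = \<zero> (D y) (C (cone_in a f))"
  let ?x = "deg0 (D y)"
  have "c_cell A ?x a (c_zero A ?x a) (c_zero A ?x a) y \<and> wl A f y = c_idcell A ?x b"
    unfolding zero_cell_wl_iff[OF f] using y f by simp
  then obtain v where "c_mor A ?x p v" "wr A \<pi> v = y"
    using pip c_obj_deg(1)[OF P] unfolding c_is_pip_def by blast
  then show "\<exists>h. \<guillemotleft>h : D y \<rightarrow> D \<pi>\<guillemotright> \<and> \<pi> \<cdot> h = y"
    using \<pi>(1) by (intro exI[of _ "fst v"]) (simp add: mor_iff wr_def)
qed

lemma copipI:
  assumes f: "c_mor A a b f" and \<pi>: "is_cokernel A (cone_out b f) \<pi>"
  shows "c_is_copip A a b f (deg1 (C \<pi>)) \<pi>"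
proof -
  let ?p = "deg1 (C \<pi>)"
  have \<pi>_type: "D \<pi> = C b" using cokernel_type[OF \<pi>] f by simp
  have extend: "\<exists>v. c_mor A ?p x v \<and> wl A v \<pi> = \<rho>"
    if \<rho>: "c_cell A b x (c_zero A b x) (c_zero A b x) \<rho> \<and> wr A \<rho> f = c_idcell A a x" for x \<rho>
  proof -
    note \<rho> = \<rho>[unfolded zero_cell_wr_iff[OF f]]
    obtain r where r: "\<guillemotleft>r : C \<pi> \<rightarrow> D x\<guillemotright>" "r \<cdot> \<pi> = \<rho>"
      using cokernel_factor[OF \<pi>, of \<rho>] \<rho> f by auto
    have "x \<cdot> r = \<zero> (C \<pi>) (C x)"
      by (rule epiD[OF cokernel_epi[OF \<pi>]]) (use r \<pi>_type \<rho> in simp_all)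
    then show ?thesis using r by (intro exI[of _ "(\<zero> Z (C x), r)"]) (simp add: mor_iff wl_def)
  qed
  have cell: "\<exists>\<gamma>. c_cell A ?p x v v' \<gamma>"
    if v: "c_mor A ?p x v" "c_mor A ?p x v'" "wl A v \<pi> = wl A v' \<pi>" for x v v'
  proof -
    have "snd v = snd v'"
      by (rule epiD[OF cokernel_epi[OF \<pi>]]) (use v in \<open>simp_all add: mor_iff wl_def\<close>)
    moreover have "fst v = fst v'" by (rule from_Z_unique) (use v in \<open>simp_all add: mor_iff\<close>)
    ultimately show ?thesis using v by (intro exI[of _ "\<zero> Z (D x)"]) (simp add: cell_iff mor_iff)
  qed
  have unique: "\<gamma> = \<gamma>'" if "c_cell A ?p x v v' \<gamma>" "c_cell A ?p x v v' \<gamma>'" for x v v' \<gamma> \<gamma>'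
    by (rule from_Z_unique) (use that in \<open>simp_all add: cell_iff\<close>)
  have "c_cell A b ?p (c_zero A b ?p) (c_zero A b ?p) \<pi> \<and> wr A \<pi> f = c_idcell A a ?p"
    unfolding zero_cell_wr_iff[OF f] using cokernelD[OF \<pi>] \<pi>_type f by simp
  then show ?thesis
    unfolding c_is_copip_def using c_obj_deg(2) extend cell unique by blast
qed

lemma ex_copip: "c_mor A a b f \<Longrightarrow> \<exists>p \<pi>. c_is_copip A a b f p \<pi>"
  using ex_cokernel[of "cone_out b f"] copipI by blast

lemma copip_exact:
  assumes f: "c_mor A a b f" and copip: "c_is_copip A a b f p \<pi>"
  shows "is_exact A (cone_out b f) \<pi>"
proof (rule exact_if_weak_cokernel)
  have "c_cell A b p (c_zero A b p) (c_zero A b p) \<pi> \<and> wr A \<pi> f = c_idcell A a p"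
    using copip unfolding c_is_copip_def by blast
  then have \<pi>: "\<guillemotleft>\<pi> : C b \<rightarrow> D p\<guillemotright>" "\<pi> \<cdot> cone_out b f = \<zero> (C a \<boxplus> D b) (D p)"
    unfolding zero_cell_wr_iff[OF f] by auto
  then show "C (cone_out b f) = D \<pi>" "\<pi> \<cdot> cone_out b f = \<zero> (D (cone_out b f)) (C \<pi>)"
    using f by simp_all
  fix y assume y: "D y = C (cone_out b f)" "y \<cdot> cone_out b f = \<zero> (D (cone_out b f)) (C y)"
  let ?x = "deg1 (C y)"
  have "c_cell A b ?x (c_zero A b ?x) (c_zero A b ?x) y \<and> wr A y f = c_idcell A a ?x"
    unfolding zero_cell_wr_iff[OF f] using y f by simp
  then obtain v where "c_mor A p ?x v" "wl A v \<pi> = y"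
    using copip c_obj_deg(2) unfolding c_is_copip_def by blast
  then show "\<exists>h. \<guillemotleft>h : C \<pi> \<rightarrow> C y\<guillemotright> \<and> h \<cdot> \<pi> = y"
    using \<pi>(1) by (intro exI[of _ "snd v"]) (simp add: mor_iff wl_def)
qed

lemma rootI:
  assumes r: "c_fully_faithful A R a r" and exact: "is_exact A (cone_out a r) \<alpha>" and \<alpha>: "C \<alpha> = D b"
  shows "c_is_root A a b \<alpha> R r"
proof -
  note R = faithful_type(1,2)[OF fully_faithful_faithful[OF r]]
    and r_mor = faithful_type(3)[OF fully_faithful_faithful[OF r]]
  note type = r_mor[unfolded mor_iff] and pullback = r[unfolded fully_faithful_iff_pullback[OF R r_mor]]
  have \<alpha>_zero: "\<alpha> \<cdot> fst r = \<zero> (C R) (D b)"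
    using exactD(1,2)[OF exact] \<alpha> type by (simp add: cone_out_def)
  have "\<exists>v \<beta>. c_mor A x R v \<and> c_cell A x a (c_comp A r v) w \<beta>"
    if x: "c_obj A x" and w: "c_mor A x a w" "wr A \<alpha> w = c_idcell A x b" for x w
  proof -
    note w_type = w(1)[unfolded mor_iff]
    obtain v \<beta> where v: "c_mor A x R v" and "\<guillemotleft>\<beta> : C x \<rightarrow> D a\<guillemotright>"
      and "fst r \<cdot> fst v = a \<cdot> \<beta> \<oplus> fst w" "snd r \<cdot> snd v = \<beta> \<cdot> x \<oplus> snd w"
      by (rule pullback_homotopy_lift[OF pullback exact[unfolded cone_out_def], of x "fst w" "snd w"])
        (use x w w_type \<alpha> type in \<open>simp_all add: c_obj_def wr_def c_idcell_def\<close>)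
    then have "c_cell A x a (c_comp A r v) w \<beta>"
      using mor_comp[OF v r_mor] w by (simp add: cell_iff c_comp_def)
    with v show ?thesis by blast
  qed
  moreover have "wr A \<alpha> r = c_idcell A R b" using \<alpha>_zero by (simp add: wr_def c_idcell_def)
  ultimately show ?thesis
    using r R r_mor unfolding c_is_root_def c_fully_faithful_def c_faithful_def by blast
qed

lemma corootI:
  assumes q: "c_fully_cofaithful A b Q q" and exact: "is_exact A \<alpha> (cone_in b q)" and \<alpha>: "D \<alpha> = C a"
  shows "c_is_coroot A a b \<alpha> Q q"
proof -
  note Q = cofaithful_type(1,2)[OF fully_cofaithful_cofaithful[OF q]]
    and q_mor = cofaithful_type(3)[OF fully_cofaithful_cofaithful[OF q]]
  note type = q_mor[unfolded mor_iff] and pushout = q[unfolded fully_cofaithful_iff_pushout[OF Q q_mor]]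
  have \<alpha>_zero: "snd q \<cdot> \<alpha> = \<zero> (C a) (D Q)"
    using exactD(1,2)[OF exact] \<alpha> type by (simp add: cone_in_def)
  have "\<exists>v \<beta>. c_mor A Q x v \<and> c_cell A b x (c_comp A v q) w \<beta>"
    if w: "c_mor A b x w" "wl A w \<alpha> = c_idcell A a x" for x w
  proof -
    note w_type = w(1)[unfolded mor_iff]
    obtain v \<beta> where v: "c_mor A Q x v" and "\<guillemotleft>\<beta> : C b \<rightarrow> D x\<guillemotright>"
      and "fst v \<cdot> fst q = x \<cdot> \<beta> \<oplus> fst w" "snd v \<cdot> snd q = \<beta> \<cdot> b \<oplus> snd w"
      by (rule pushout_homotopy_extend[OF pushout exact[unfolded cone_in_def], of "snd w" x "fst w"])
        (use Q w w_type \<alpha> type in \<open>simp_all add: c_obj_def wl_def c_idcell_def\<close>)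
    then have "c_cell A b x (c_comp A v q) w \<beta>"
      using mor_comp[OF q_mor v] w by (simp add: cell_iff c_comp_def)
    with v show ?thesis by blast
  qed
  moreover have "wl A q \<alpha> = c_idcell A a Q" using \<alpha>_zero by (simp add: wl_def c_idcell_def)
  ultimately show ?thesis
    using q Q q_mor unfolding c_is_coroot_def c_fully_cofaithful_def c_cofaithful_def by blast
qed

lemma ex_root:
  assumes a: "c_obj A a" and \<alpha>: "c_cell A a b (c_zero A a b) (c_zero A a b) \<alpha>"
  shows "\<exists>R r. c_is_root A a b \<alpha> R r"
proof -
  have \<alpha>_type: "\<guillemotleft>\<alpha> : C a \<rightarrow> D b\<guillemotright>" and \<alpha>_a: "\<alpha> \<cdot> a = \<zero> (D a) (D b)"
    using \<alpha> by (simp_all add: zero_cell_iff)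
  obtain r0 where r0: "projective A (D r0)" "is_exact A r0 \<alpha>" by (rule ex_projective_exact)
  have r0_type: "C r0 = C a" using exact_type[OF r0(2)] \<alpha>_type by simp
  then obtain R r1 where pullback: "is_pullback A r0 a R r1" by (rule ex_pullback)
  note type = pullback_type[OF pullback]
  have R: "c_obj A R" and r: "c_mor A R a (r0, r1)"
    using r0(1) type pullback_commutes[OF pullback] by (simp_all add: c_obj_def mor_iff)
  have "c_fully_faithful A R a (r0, r1)" using pullback fully_faithful_iff_pullback[OF R a r] by simp
  moreover have "is_exact A (cone_out a (r0, r1)) \<alpha>"
    unfolding cone_out_def using exact_copair[OF r0(2), of "\<ominus> a"] \<alpha>_type \<alpha>_a r0_type by simp
  ultimately have "c_is_root A a b \<alpha> R (r0, r1)" using \<alpha>_type by (intro rootI) simp_all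
  then show ?thesis by blast
qed

lemma ex_coroot:
  assumes b: "c_obj A b" and \<alpha>: "c_cell A a b (c_zero A a b) (c_zero A a b) \<alpha>"
  shows "\<exists>Q q. c_is_coroot A a b \<alpha> Q q"
proof -
  have \<alpha>_type: "\<guillemotleft>\<alpha> : C a \<rightarrow> D b\<guillemotright>" and b_\<alpha>: "b \<cdot> \<alpha> = \<zero> (C a) (C b)"
    using \<alpha> by (simp_all add: zero_cell_iff)
  obtain q where q: "is_cokernel A \<alpha> q" using ex_cokernel by blast
  have q_type: "D q = D b" using cokernel_type[OF q] \<alpha>_type by simp
  obtain Q where Q: "\<guillemotleft>Q : C q \<rightarrow> C b\<guillemotright>" "Q \<cdot> q = b" using cokernel_factor[OF q, of b] \<alpha>_type b_\<alpha> by auto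
  let ?q = "(I (C b), q)"
  have Q_obj: "c_obj A Q" and q_mor: "c_mor A b Q ?q"
    using b Q q_type by (simp_all add: c_obj_def mor_iff)
  have "is_pushout A b q (I (C b)) Q"
  proof (rule pushoutI)
    fix x y assume xy: "C x = C y" "D x = C b" "D y = C q" "x \<cdot> b = y \<cdot> q"
    have "x \<cdot> Q = y" by (rule epiD[OF cokernel_epi[OF q]]) (use xy Q q_type in simp_all)
    then show "\<exists>h. \<guillemotleft>h : C Q \<rightarrow> C y\<guillemotright> \<and> h \<cdot> I (C b) = x \<and> h \<cdot> Q = y"
      using xy Q by (intro exI[of _ x]) simp
  qed (use Q q_type in simp_all)
  then have "c_fully_cofaithful A b Q ?q" using fully_cofaithful_iff_pushout[OF b Q_obj q_mor] by simp
  moreover have "is_exact A \<alpha> (cone_in b ?q)"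
    unfolding cone_in_def using exact_pair[OF cokernel_exact[OF q], of b] \<alpha>_type b_\<alpha> q_type by simp
  ultimately have "c_is_coroot A a b \<alpha> Q ?q" using \<alpha>_type by (intro corootI) simp_all
  then show ?thesis by blast
qed

lemma fully_faithful_is_root:
  assumes f: "c_fully_faithful A a b f" and copip: "c_is_copip A a b f p \<pi>"
  shows "c_is_root A b p \<pi> a f"
proof (rule rootI[OF f])
  show "is_exact A (cone_out b f) \<pi>"
    using faithful_type(3)[OF fully_faithful_faithful[OF f]] copip by (rule copip_exact)
  show "C \<pi> = D p" using copip unfolding c_is_copip_def by (simp add: cell_iff)
qed

lemma fully_cofaithful_is_coroot:
  assumes f: "c_fully_cofaithful A a b f" and pip: "c_is_pip A a b f p \<pi>"
  shows "c_is_coroot A p a \<pi> b f"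
proof (rule corootI[OF f])
  show "is_exact A \<pi> (cone_in a f)"
    using cofaithful_type(3)[OF fully_cofaithful_cofaithful[OF f]] pip by (rule pip_exact)
  show "D \<pi> = C p" using pip unfolding c_is_pip_def by (simp add: cell_iff)
qed

section \<open>Biproducts and 2-additivity\<close>

lemma zero_obj_Z: "c_zero_obj A (\<zero> Z Z)"
  unfolding c_zero_obj_def
  using c_obj_deg(2)[of Z] mor_zero ex1_cell_to_zero ex1_cell_from_zero by blast

lemma ex_2biproduct:
  assumes a: "c_obj A a" and b: "c_obj A b"
  shows "\<exists>s i1 i2 p1 p2 \<alpha>1 \<alpha>2 \<alpha>3 \<alpha>4 \<alpha>5. c_obj A s \<and>
           c_mor A a s i1 \<and> c_mor A b s i2 \<and> c_mor A s a p1 \<and> c_mor A s b p2 \<and>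
           c_cell A a a (c_comp A p1 i1) (c_id A a) \<alpha>1 \<and>
           c_cell A b b (c_comp A p2 i2) (c_id A b) \<alpha>2 \<and>
           c_cell A b a (c_comp A p1 i2) (c_zero A b a) \<alpha>3 \<and>
           c_cell A a b (c_comp A p2 i1) (c_zero A a b) \<alpha>4 \<and>
           c_cell A s s (c_add A (c_comp A i1 p1) (c_comp A i2 p2)) (c_id A s) \<alpha>5"
proof -
  define s where "s = in1 (C a) (C b) \<cdot> a \<nabla> in2 (C a) (C b) \<cdot> b"
  define i1 i2 p1 p2 where "i1 = (in1 (C a) (C b), in1 (D a) (D b))"
    and "i2 = (in2 (C a) (C b), in2 (D a) (D b))"
    and "p1 = (pr1 (C a) (C b), pr1 (D a) (D b))" and "p2 = (pr2 (C a) (C b), pr2 (D a) (D b))"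
  note defs = s_def i1_def i2_def p1_def p2_def
  have "c_obj A s" using a b projective_bsum by (simp add: c_obj_def s_def)
  moreover have "c_mor A a s i1" "c_mor A b s i2" "c_mor A s a p1" "c_mor A s b p2"
    using pr_in[of "C a" "C b", THEN cmp_eq] by (simp_all add: mor_iff defs copair_def)
  moreover have "c_cell A a a (c_comp A p1 i1) (c_id A a) (\<zero> (C a) (D a))"
    "c_cell A b b (c_comp A p2 i2) (c_id A b) (\<zero> (C b) (D b))"
    "c_cell A b a (c_comp A p1 i2) (c_zero A b a) (\<zero> (C b) (D a))"
    "c_cell A a b (c_comp A p2 i1) (c_zero A a b) (\<zero> (C a) (D b))"
    "c_cell A s s (c_add A (c_comp A i1 p1) (c_comp A i2 p2)) (c_id A s) (\<zero> (C s) (D s))"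
    by (simp_all add: c_simps defs in_pr)
  ultimately show ?thesis by blast
qed

lemma cell_inverse: "c_cell A a b f g \<alpha> \<Longrightarrow> c_cell A a b g f (\<ominus> \<alpha>)"
  by (auto simp: cell_iff mor_iff)

lemma two_additive: "c_two_additive A"
  unfolding c_two_additive_def
  by (intro conjI allI impI; (elim conjE)?)
    (assumption | rule exI, rule zero_obj_Z | rule ex_2biproduct cell_inverse
      | (auto simp: c_simps prod_eq_iff add_ac; fail))+

theorem two_abelian: "c_two_abelian A"
  unfolding c_two_abelian_def
  by (intro conjI allI impI; (elim conjE)?)
    (assumption | rule two_additive ex_2kernel ex_2cokernel ex_pip ex_copip ex_root ex_coroot
      faithful_is_2kernel cofaithful_is_2cokernel fully_faithful_is_root fully_cofaithful_is_coroot)+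

end

section \<open>Discrete and codiscrete objects\<close>

context abelian_category
begin

definition cok :: "'m \<Rightarrow> 'm" where
  "cok a = (SOME c. is_cokernel A a c)"

definition cok_map :: "'m \<Rightarrow> 'm \<Rightarrow> 'm \<Rightarrow> 'm" where
  "cok_map a b f = (SOME h. \<guillemotleft>h : C (cok a) \<rightarrow> C (cok b)\<guillemotright> \<and> h \<cdot> cok a = cok b \<cdot> f)"

definition ker :: "'m \<Rightarrow> 'm" where
  "ker a = (SOME k. is_kernel A a k)"

definition ker_map :: "'m \<Rightarrow> 'm \<Rightarrow> 'm \<Rightarrow> 'm" where
  "ker_map a b f = (SOME h. \<guillemotleft>h : D (ker a) \<rightarrow> D (ker b)\<guillemotright> \<and> ker b \<cdot> h = f \<cdot> ker a)"

lemma cok_opposite: "abelian_category.cok (opposite A) = ker"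
  by (simp add: fun_eq_iff ker_def abelian_category.cok_def[OF opposite_abelian_category])

lemma cok_map_opposite: "abelian_category.cok_map (opposite A) b a = ker_map a b"
  by (simp add: fun_eq_iff ker_map_def abelian_category.cok_map_def[OF opposite_abelian_category]
      cok_opposite conj_commute)

lemma is_cokernel_cok: "is_cokernel A a (cok a)"
  unfolding cok_def using ex_cokernel by (rule someI_ex)

lemma is_kernel_ker: "is_kernel A a (ker a)"
  unfolding ker_def using ex_kernel by (rule someI_ex)

lemmas cok_type [simp] = cokernel_type[OF is_cokernel_cok]
lemmas cok_zero = cokernel_zero[OF is_cokernel_cok]
lemmas ker_type [simp] = kernel_type[OF is_kernel_ker]

lemma cok_map_square:
  assumes "c_mor A a b f"
  shows "\<guillemotleft>cok_map a b (fst f) : C (cok a) \<rightarrow> C (cok b)\<guillemotright>" "cok_map a b (fst f) \<cdot> cok a = cok b \<cdot> fst f"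
proof -
  note type = assms[unfolded mor_iff]
  have "cok b \<cdot> b \<cdot> snd f = \<zero> (D a) (C (cok b))"
    using cmp_eq[OF cok_zero[of b], of "snd f"] type by simp
  then obtain h where "\<guillemotleft>h : C (cok a) \<rightarrow> C (cok b)\<guillemotright> \<and> h \<cdot> cok a = cok b \<cdot> fst f"
    using cokernel_factor[OF is_cokernel_cok, of "cok b \<cdot> fst f" a] type by auto
  then have "\<guillemotleft>cok_map a b (fst f) : C (cok a) \<rightarrow> C (cok b)\<guillemotright>
    \<and> cok_map a b (fst f) \<cdot> cok a = cok b \<cdot> fst f"
    unfolding cok_map_def by (rule someI)
  then show "\<guillemotleft>cok_map a b (fst f) : C (cok a) \<rightarrow> C (cok b)\<guillemotright>"
    "cok_map a b (fst f) \<cdot> cok a = cok b \<cdot> fst f"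
    by blast+
qed

lemma cok_map_eqI:
  assumes "c_mor A a b f" "\<guillemotleft>h : C (cok a) \<rightarrow> C (cok b)\<guillemotright>" "h \<cdot> cok a = cok b \<cdot> fst f"
  shows "cok_map a b (fst f) = h"
  by (rule epiD[OF cokernel_epi[OF is_cokernel_cok]]) (use assms cok_map_square[OF assms(1)] in simp_all)

lemma cok_map_id: "cok_map a a (I (C a)) = I (C (cok a))"
  using cok_map_eqI[OF mor_id] by (simp add: c_id_def)

lemma cok_map_comp:
  assumes f: "c_mor A a b f" and g: "c_mor A b c g"
  shows "cok_map a c (fst g \<cdot> fst f) = cok_map b c (fst g) \<cdot> cok_map a b (fst f)"
proof -
  have "(cok_map b c (fst g) \<cdot> cok_map a b (fst f)) \<cdot> cok a = cok c \<cdot> fst (c_comp A g f)"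
    using cok_map_square[OF f] cok_map_square(1)[OF g] cmp_eq[OF cok_map_square(2)[OF g], of "fst f"] f g
    by (simp add: mor_iff c_comp_def)
  then have "cok_map a c (fst (c_comp A g f)) = cok_map b c (fst g) \<cdot> cok_map a b (fst f)"
    using cok_map_square(1)[OF f] cok_map_square(1)[OF g]
    by (intro cok_map_eqI[OF mor_comp[OF f g]]) simp_all
  then show ?thesis by (simp add: c_comp_def)
qed

lemma cok_map_cell:
  assumes "c_cell A a b f g \<alpha>"
  shows "cok_map a b (fst f) = cok_map a b (fst g)"
proof -
  have f: "c_mor A a b f" and g: "c_mor A a b g" using assms by (simp_all add: cell_iff)
  have "cok b \<cdot> fst f = cok b \<cdot> fst g"
    using assms f g cmp_eq[OF cok_zero[of b], of \<alpha>] by (simp add: cell_iff mor_iff)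
  then show ?thesis using cok_map_square[OF g] by (intro cok_map_eqI[OF f]) simp_all
qed

lemma cell_if_cok_map_eq:
  assumes b: "mono A b" and f: "c_mor A a b f" and g: "c_mor A a b g"
    and eq: "cok_map a b (fst f) = cok_map a b (fst g)"
  shows "\<exists>\<alpha>. c_cell A a b f g \<alpha>"
proof -
  note type = f[unfolded mor_iff] g[unfolded mor_iff]
  have "cok b \<cdot> (fst f \<oplus> \<ominus> (fst g)) = \<zero> (C a) (C (cok b))"
    using cok_map_square(2)[OF f] cok_map_square(2)[OF g] eq type by simp
  then obtain \<alpha> where \<alpha>: "\<guillemotleft>\<alpha> : C a \<rightarrow> D b\<guillemotright>" "b \<cdot> \<alpha> = fst f \<oplus> \<ominus> (fst g)"
    using kernel_factor[OF mono_is_kernel[OF b is_cokernel_cok], of "fst f \<oplus> \<ominus> (fst g)"] type by auto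
  have "snd f = \<alpha> \<cdot> a \<oplus> snd g"
    by (rule monoD[OF b]) (use \<alpha>(1) cmp_eq[OF \<alpha>(2), of a] type in simp_all)
  then show ?thesis using \<alpha> f g type by (intro exI[of _ \<alpha>]) (simp add: cell_iff)
qed

lemma ker_map_square:
  assumes "c_mor A a b f"
  shows "\<guillemotleft>ker_map a b (snd f) : D (ker a) \<rightarrow> D (ker b)\<guillemotright>" "ker b \<cdot> ker_map a b (snd f) = snd f \<cdot> ker a"
  using abelian_category.cok_map_square[OF opposite_abelian_category, of b a "prod.swap f"] assms
  by (simp_all add: cok_opposite cok_map_opposite)

lemma ker_map_eqI:
  assumes "c_mor A a b f" "\<guillemotleft>h : D (ker a) \<rightarrow> D (ker b)\<guillemotright>" "ker b \<cdot> h = snd f \<cdot> ker a"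
  shows "ker_map a b (snd f) = h"
  using abelian_category.cok_map_eqI[OF opposite_abelian_category, of b a "prod.swap f" h] assms
  by (simp add: cok_opposite cok_map_opposite)

lemma ker_map_id: "ker_map a a (I (D a)) = I (D (ker a))"
  using abelian_category.cok_map_id[OF opposite_abelian_category, of a]
  by (simp add: cok_opposite cok_map_opposite)

lemma ker_map_comp:
  assumes "c_mor A a b f" "c_mor A b c g"
  shows "ker_map a c (snd g \<cdot> snd f) = ker_map b c (snd g) \<cdot> ker_map a b (snd f)"
  using abelian_category.cok_map_comp[OF opposite_abelian_category,
      of c b "prod.swap g" a "prod.swap f"] assms
  by (simp add: cok_map_opposite)

lemma ker_map_cell: "c_cell A a b f g \<alpha> \<Longrightarrow> ker_map a b (snd f) = ker_map a b (snd g)"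
  using abelian_category.cok_map_cell[OF opposite_abelian_category,
      of b a "prod.swap f" "prod.swap g" \<alpha>]
  by (simp add: cok_map_opposite)

lemma cell_if_ker_map_eq:
  assumes "epi A a" "c_mor A a b f" "c_mor A a b g" "ker_map a b (snd f) = ker_map a b (snd g)"
  shows "\<exists>\<alpha>. c_cell A a b f g \<alpha>"
  using abelian_category.cell_if_cok_map_eq[OF opposite_abelian_category,
      of a b "prod.swap f" "prod.swap g"] assms
  by (simp add: cok_map_opposite)

lemma cok_map_full:
  assumes a: "projective A (C a)" and b: "mono A b" and h: "\<guillemotleft>h : C (cok a) \<rightarrow> C (cok b)\<guillemotright>"
  shows "\<exists>f. c_mor A a b f \<and> cok_map a b (fst f) = h"
proof -
  obtain f0 where f0: "\<guillemotleft>f0 : C a \<rightarrow> C b\<guillemotright>" "cok b \<cdot> f0 = h \<cdot> cok a"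
    using projective_lift[OF cokernel_epi[OF is_cokernel_cok[of b]], of "h \<cdot> cok a"] a h by auto
  have "cok b \<cdot> f0 \<cdot> a = \<zero> (D a) (C (cok b))"
    using cmp_eq[OF f0(2), of a] f0(1) h cok_zero[of a] by simp
  then obtain f1 where f1: "\<guillemotleft>f1 : D a \<rightarrow> D b\<guillemotright>" "b \<cdot> f1 = f0 \<cdot> a"
    using kernel_factor[OF mono_is_kernel[OF b is_cokernel_cok], of "f0 \<cdot> a"] f0(1) by auto
  have "c_mor A a b (f0, f1)" using f0(1) f1 by (simp add: mor_iff)
  then show ?thesis using cok_map_eqI[of a b "(f0, f1)" h] f0(2) h by auto
qed

lemma ker_map_full:
  assumes a: "projective A (C a)" "epi A a" and h: "\<guillemotleft>h : D (ker a) \<rightarrow> D (ker b)\<guillemotright>"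
  shows "\<exists>f. c_mor A a b f \<and> ker_map a b (snd f) = h"
proof -
  let ?z = "\<zero> Z (D (ker a))"
  have "is_exact A ?z (ker a)"
  proof (rule exact_if_weak_kernel)
    fix y assume y: "C y = D (ker a)" "ker a \<cdot> y = \<zero> (D y) (C (ker a))"
    have "y = \<zero> (D y) (D (ker a))"
      by (rule monoD[OF kernel_mono[OF is_kernel_ker]]) (use y in simp_all)
    then show "\<exists>h. \<guillemotleft>h : D y \<rightarrow> D ?z\<guillemotright> \<and> ?z \<cdot> h = y" by (intro exI[of _ "\<zero> (D y) Z"]) simp
  qed simp_all
  then obtain f1 where f1: "\<guillemotleft>f1 : D a \<rightarrow> D b\<guillemotright>" "f1 \<cdot> ker a = ker b \<cdot> h"
    using extend_along_exact[OF _ kernel_exact[OF is_kernel_ker] a(2,1), of ?z "ker b \<cdot> h"] h by auto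
  obtain f0 where f0: "\<guillemotleft>f0 : C a \<rightarrow> C b\<guillemotright>" "f0 \<cdot> a = b \<cdot> f1"
    using cokernel_factor[OF epi_is_cokernel[OF a(2) is_kernel_ker], of "b \<cdot> f1"]
      f1 h kernel_zero[OF is_kernel_ker, of b] cmp_eq[OF kernel_zero[OF is_kernel_ker[of b]], of h]
        by auto
  have "c_mor A a b (f0, f1)" using f0 f1(1) by (simp add: mor_iff)
  then show ?thesis using ker_map_eqI[of a b "(f0, f1)" h] f1(2) h by auto
qed

end

context abelian_with_projectives
begin

lemma discrete_iff_mono: "c_discrete A a \<longleftrightarrow> c_obj A a \<and> mono A a"
proof
  assume discrete: "c_discrete A a"
  let ?t = "c_zero A a (\<zero> Z Z)"
  have a: "c_obj A a" using discrete unfolding c_discrete_def by blast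
  have "c_faithful A a (\<zero> Z Z) ?t"
    using discrete zero_obj_Z mor_zero unfolding c_discrete_def by blast
  then have mono: "mono A (cone_in a ?t)"
    using faithful_iff_mono[OF a c_obj_deg(2) mor_zero] by simp
  have "mono A a"
    by (rule monoI, rule monoD[OF mono]) (simp_all add: cone_in_def c_zero_def)
  with a show "c_obj A a \<and> mono A a" by blast
next
  assume a: "c_obj A a \<and> mono A a"
  have "c_faithful A a z t" if z: "c_zero_obj A z" "c_mor A a z t" for z t
  proof -
    have "mono A (cone_in a t)"
      by (rule monoI, rule monoD[OF conjunct2[OF a]])
        (use z(2) in \<open>simp_all add: mor_iff cone_in_def\<close>)
    then show ?thesis using faithful_iff_mono[of a z t] a z by (simp add: c_zero_obj_def)
  qed
  with a show "c_discrete A a" unfolding c_discrete_def by blast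
qed

lemma codiscrete_iff_epi: "c_codiscrete A a \<longleftrightarrow> c_obj A a \<and> epi A a"
proof
  assume codiscrete: "c_codiscrete A a"
  let ?t = "c_zero A (\<zero> Z Z) a"
  have a: "c_obj A a" using codiscrete unfolding c_codiscrete_def by blast
  have "c_cofaithful A (\<zero> Z Z) a ?t"
    using codiscrete zero_obj_Z mor_zero unfolding c_codiscrete_def by blast
  then have epi: "epi A (cone_out a ?t)"
    using cofaithful_iff_epi[OF c_obj_deg(2) a mor_zero] by simp
  have "epi A a"
    by (rule epiI, rule epiD[OF epi]) (simp_all add: cone_out_def c_zero_def)
  with a show "c_obj A a \<and> epi A a" by blast
next
  assume a: "c_obj A a \<and> epi A a"
  have "c_cofaithful A z a t" if z: "c_zero_obj A z" "c_mor A z a t" for z t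
  proof -
    have "epi A (cone_out a t)"
      by (rule epiI, rule epiD[OF conjunct2[OF a]])
        (use z(2) in \<open>simp_all add: mor_iff cone_out_def\<close>)
    then show ?thesis using cofaithful_iff_epi[of z a t] a z by (simp add: c_zero_obj_def)
  qed
  with a show "c_codiscrete A a" unfolding c_codiscrete_def by blast
qed

lemma ex_discrete_cok: "\<exists>a. c_discrete A a \<and> isomorphic A (C (cok a)) X"
proof -
  obtain e where e: "projective A (D e)" "epi A e" "C e = X" by (rule projective_cover)
  obtain n where n: "is_kernel A e n" using ex_kernel by blast
  have "c_discrete A n"
    using discrete_iff_mono kernel_mono[OF n] kernel_type[OF n] e(1) by (simp add: c_obj_def)
  moreover have "isomorphic A (C (cok n)) X"
    using cokernels_isomorphic[OF is_cokernel_cok epi_is_cokernel[OF e(2) n]] e(3) by simp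
  ultimately show ?thesis by blast
qed

lemma ex_codiscrete_ker: "\<exists>a. c_codiscrete A a \<and> isomorphic A (D (ker a)) X"
proof -
  have "is_kernel A (deg1 X) (I X)"
    by (rule kernelI) (auto intro: monoI)
  then have "isomorphic A (D (ker (deg1 X))) X"
    using kernels_isomorphic[OF is_kernel_ker, of "deg1 X" "I X"] by simp
  moreover have "c_codiscrete A (deg1 X)" using codiscrete_iff_epi c_obj_deg(2) epi_to_Z by blast
  ultimately show ?thesis by blast
qed

theorem discrete_equivalence: "discrete_equiv_via_coker A"
  unfolding discrete_equiv_via_coker_def
proof (intro exI[of _ cok] exI[of _ "\<lambda>a. C (cok a)"]
    exI[of _ "\<lambda>a b f. cok_map a b (fst f)"] conjI allI impI; (elim conjE)?)
  show "\<exists>f. c_mor A a b f \<and> cok_map a b (fst f) = h"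
    if "c_discrete A a" "c_discrete A b" "h \<in> hom A (C (cok a)) (C (cok b))" for a b h
    using that cok_map_full[of a b h] by (simp add: discrete_iff_mono c_obj_def)
  show "\<exists>a. c_discrete A a \<and> isomorphic A (C (cok a)) X" for X by (rule ex_discrete_cok)
qed (auto simp: is_cokernel_cok cok_map_square cok_map_id cok_map_comp c_id_def c_comp_def
    discrete_iff_mono intro: cok_map_cell cell_if_cok_map_eq)

theorem codiscrete_equivalence: "codiscrete_equiv_via_ker A"
  unfolding codiscrete_equiv_via_ker_def
proof (intro exI[of _ ker] exI[of _ "\<lambda>a. D (ker a)"]
    exI[of _ "\<lambda>a b f. ker_map a b (snd f)"] conjI allI impI; (elim conjE)?)
  show "\<exists>f. c_mor A a b f \<and> ker_map a b (snd f) = h"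
    if "c_codiscrete A a" "c_codiscrete A b" "h \<in> hom A (D (ker a)) (D (ker b))" for a b h
    using that ker_map_full[of a h b] by (simp add: codiscrete_iff_epi c_obj_def)
  show "\<exists>a. c_codiscrete A a \<and> isomorphic A (D (ker a)) X" for X by (rule ex_codiscrete_ker)
qed (auto simp: is_kernel_ker ker_map_square ker_map_id ker_map_comp c_id_def c_comp_def
    codiscrete_iff_epi intro: ker_map_cell cell_if_ker_map_eq)

end

theorem theorem3p1:
  fixes A :: "('o, 'm) acat"
  assumes "abelian A" and "enough_projectives A"
  shows "c_two_abelian A \<and> discrete_equiv_via_coker A \<and> codiscrete_equiv_via_ker A"
proof -
  interpret abelian_with_projectives A
    using assms by unfold_locales (auto simp: abelian_def)
  show ?thesis using two_abelian discrete_equivalence codiscrete_equivalence by blast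
qed

end
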